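(* Let $\mathscr V$ be a cosmos, let $\mathscr B$ be a small $\mathscr V$-category with (essentially) small Cauchy completion, and let $C$ be a comonad on $\mathscr B$ in $\mathbf{Mod}(\mathscr V)$, that is, a cocontinuous comonad on $\mathcal P\mathscr B$. Let $V\colon(\mathcal P\mathscr B)_C\to\mathcal P\mathscr B$ be the forgetful functor from $C$-comodules, $W$ its right adjoint, $K\colon\operatorname{Rep}(C)\to(\mathcal P\mathscr B)_C$ the inclusion of the Cauchy comodules, and $\varepsilon^K\colon L_K\widetilde K\Rightarrow\mathrm{id}$ the counit of the adjunction $L_K\dashv\widetilde K$. Then the $C$-component of the counit of the Tannakian adjunction is given by $$V\varepsilon^KW\colon VL_K\widetilde KW\Rightarrow VW=C,$$ which is invertible if and only if $\varepsilon^KW$ is invertible.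
   Context: A cosmos is a complete and cocomplete symmetric monoidal closed category. $\mathcal P\mathscr A=[\mathscr A^{\mathrm{op}},\mathscr V]$. The Cauchy completion $\overline{\mathscr B}\subseteq\mathcal P\mathscr B$ is the full subcategory of those $F$ such that $\mathcal P\mathscr B(F,-)$ preserves all small weighted colimits. $\operatorname{Rep}(C)$ is the full sub-$\mathscr V$-category of the $\mathscr V$-category $(\mathcal P\mathscr B)_C$ of $C$-comodules on those whose underlying object lies in $\overline{\mathscr B}$ (Cauchy comodules). $W$ sends $X$ to $(CX,\delta_X)$, $\delta$ the comultiplication of $C$. $L_K\colon\mathcal P\operatorname{Rep}(C)\to(\mathcal P\mathscr B)_C$ is the left Kan extension of $K$ along the Yoneda embedding; its right adjoint is $\widetilde K(X)=(\mathcal P\mathscr B)_C(K-,X)$. The Tannakian adjunction is the biadjunction between comonads on $\mathscr B$ in the 2-category with objects small $\mathscr V$-categories and 1-cells $\mathscr A\to\mathscr B$ the cocontinuous $\mathscr V$-functors $\mathcal P\mathscr A\to\mathcal P\mathscr B$ (a 2-category biequivalent to $\mathbf{Mod}(\mathscr V)$) and maps into $\mathscr B$ (1-cells $w$ with a chosen right adjoint $\overline w$ in this 2-category). Its left biadjoint sends $w$ to the comonad $L(w)=w\overline w$, and its right biadjoint sends $C$ to $v_C:=VL_K$, with right adjoint $\overline{v_C}=\widetilde KW$, equipped with the coaction $\rho_C=\rho L_K\colon v_C\Rightarrow Cv_C$, where $\rho\colon V\Rightarrow CV$, $\rho_{(M,r)}=r$. The $C$-component of the counit is the morphism of comonads $L(v_C)=v_C\overline{v_C}\to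 C$ given by the composite $$v_C\overline{v_C}\xrightarrow{\ \rho_C\overline{v_C}\ }Cv_C\overline{v_C}\xrightarrow{\ C\varepsilon\ }C,$$ with $\varepsilon$ the counit of $v_C\dashv\overline{v_C}$. *)

theory Defs
  imports "HOL-Library.FuncSet"
begin

unbundle cardinal_syntax

section \<open>Smallness\<close>

text \<open>Smallness is measured by a universe, given as a regular strong limit cardinal \<open>U\<close> on some
  type: a set is small if its cardinality is below \<open>U\<close>. An uncountable \<open>U\<close> is a strongly
  inaccessible cardinal, that is, a Grothendieck universe; \<open>U = natLeq\<close> is not excluded.\<close>

definition universe :: "'u rel \<Rightarrow> bool" where
  "universe U \<longleftrightarrow> Cinfinite U \<and> regularCard U \<and>
     (\<forall>A \<subseteq> Field U. |A| <o U \<longrightarrow> |Pow A| <o U)"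

section \<open>Ordinary categories, limits and colimits\<close>

record ('o, 'a) cat =
  Obj :: "'o set"
  Arr :: "'a set"
  Dom :: "'a \<Rightarrow> 'o"
  Cod :: "'a \<Rightarrow> 'o"
  Idn :: "'o \<Rightarrow> 'a"
  Cmp :: "'a \<Rightarrow> 'a \<Rightarrow> 'a"  (infixr "\<cdot>\<index>" 65)

definition hom :: "('o, 'a, 'z) cat_scheme \<Rightarrow> 'o \<Rightarrow> 'o \<Rightarrow> 'a set" where
  "hom C x y = {f \<in> Arr C. Dom C f = x \<and> Cod C f = y}"

locale category =
  fixes C :: "('o, 'a, 'z) cat_scheme" (structure)
  assumes dom_in: "f \<in> Arr C \<Longrightarrow> Dom C f \<in> Obj C"
    and cod_in: "f \<in> Arr C \<Longrightarrow> Cod C f \<in> Obj C"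
    and idn_in: "x \<in> Obj C \<Longrightarrow> Idn C x \<in> hom C x x"
    and cmp_in: "\<lbrakk>f \<in> hom C x y; g \<in> hom C y z\<rbrakk> \<Longrightarrow> g \<cdot> f \<in> hom C x z"
    and idn_left: "f \<in> hom C x y \<Longrightarrow> Idn C y \<cdot> f = f"
    and idn_right: "f \<in> hom C x y \<Longrightarrow> f \<cdot> Idn C x = f"
    and cmp_assoc: "\<lbrakk>f \<in> hom C w x; g \<in> hom C x y; h \<in> hom C y z\<rbrakk> \<Longrightarrow> (h \<cdot> g) \<cdot> f = h \<cdot> (g \<cdot> f)"

definition inverse_arrows :: "('o, 'a, 'z) cat_scheme \<Rightarrow> 'a \<Rightarrow> 'a \<Rightarrow> bool" where
  "inverse_arrows C f g \<longleftrightarrow> f \<in> Arr C \<and> g \<in> hom C (Cod C f) (Dom C f) \<and>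
     g \<cdot>\<^bsub>C\<^esub> f = Idn C (Dom C f) \<and> f \<cdot>\<^bsub>C\<^esub> g = Idn C (Cod C f)"

definition iso :: "('o, 'a, 'z) cat_scheme \<Rightarrow> 'a \<Rightarrow> bool" where
  "iso C f \<longleftrightarrow> (\<exists>g. inverse_arrows C f g)"

definition inv_arr :: "('o, 'a, 'z) cat_scheme \<Rightarrow> 'a \<Rightarrow> 'a" where
  "inv_arr C f = (THE g. inverse_arrows C f g)"

definition op_cat :: "('o, 'a, 'z) cat_scheme \<Rightarrow> ('o, 'a) cat" where
  "op_cat C = \<lparr>Obj = Obj C, Arr = Arr C, Dom = Cod C, Cod = Dom C, Idn = Idn C,
     Cmp = (\<lambda>g f. f \<cdot>\<^bsub>C\<^esub> g)\<rparr>"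

definition diagram ::
  "('i, 'j, 'y) cat_scheme \<Rightarrow> ('o, 'a, 'z) cat_scheme \<Rightarrow> ('i \<Rightarrow> 'o) \<Rightarrow> ('j \<Rightarrow> 'a) \<Rightarrow> bool" where
  "diagram J C Do Da \<longleftrightarrow>
     (\<forall>i \<in> Obj J. Do i \<in> Obj C) \<and>
     (\<forall>u \<in> Arr J. Da u \<in> hom C (Do (Dom J u)) (Do (Cod J u))) \<and>
     (\<forall>i \<in> Obj J. Da (Idn J i) = Idn C (Do i)) \<and>
     (\<forall>u \<in> Arr J. \<forall>v \<in> Arr J. Cod J u = Dom J v \<longrightarrow> Da (v \<cdot>\<^bsub>J\<^esub> u) = Da v \<cdot>\<^bsub>C\<^esub> Da u)"

definition cone ::
  "('i, 'j, 'y) cat_scheme \<Rightarrow> ('o, 'a, 'z) cat_scheme \<Rightarrow> ('i \<Rightarrow> 'o) \<Rightarrow> ('j \<Rightarrow> 'a) \<Rightarrow>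
   'o \<Rightarrow> ('i \<Rightarrow> 'a) \<Rightarrow> bool" where
  "cone J C Do Da l p \<longleftrightarrow> l \<in> Obj C \<and> (\<forall>i \<in> Obj J. p i \<in> hom C l (Do i)) \<and>
     (\<forall>u \<in> Arr J. Da u \<cdot>\<^bsub>C\<^esub> p (Dom J u) = p (Cod J u))"

definition limit_cone ::
  "('i, 'j, 'y) cat_scheme \<Rightarrow> ('o, 'a, 'z) cat_scheme \<Rightarrow> ('i \<Rightarrow> 'o) \<Rightarrow> ('j \<Rightarrow> 'a) \<Rightarrow>
   'o \<Rightarrow> ('i \<Rightarrow> 'a) \<Rightarrow> bool" where
  "limit_cone J C Do Da l p \<longleftrightarrow> cone J C Do Da l p \<and>
     (\<forall>x q. cone J C Do Da x q \<longrightarrow> (\<exists>!h. h \<in> hom C x l \<and> (\<forall>i \<in> Obj J. p i \<cdot>\<^bsub>C\<^esub> h = q i)))"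

text \<open>Every small category is isomorphic to one whose objects and arrows are elements of the type
  \<open>'u\<close> carrying \<open>U\<close>, so it is enough to index diagrams by those.\<close>

definition complete :: "'u rel \<Rightarrow> ('o, 'a, 'z) cat_scheme \<Rightarrow> bool" where
  "complete U C \<longleftrightarrow> (\<forall>(J :: ('u, 'u) cat) Do Da.
     category J \<and> |Obj J| <o U \<and> |Arr J| <o U \<and> diagram J C Do Da \<longrightarrow>
     (\<exists>l p. limit_cone J C Do Da l p))"

definition cocomplete :: "'u rel \<Rightarrow> ('o, 'a, 'z) cat_scheme \<Rightarrow> bool" where
  "cocomplete U C \<longleftrightarrow> complete U (op_cat C)"

definition locally_small :: "'u rel \<Rightarrow> ('o, 'a, 'z) cat_scheme \<Rightarrow> bool" where
  "locally_small U C \<longleftrightarrow> (\<forall>x \<in> Obj C. \<forall>y \<in> Obj C. |hom C x y| <o U)"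

definition is_equalizer :: "('o, 'a, 'z) cat_scheme \<Rightarrow> 'o \<Rightarrow> 'a \<Rightarrow> 'a \<Rightarrow> 'a \<Rightarrow> bool" where
  "is_equalizer C e i f g \<longleftrightarrow> i \<in> hom C e (Dom C f) \<and> f \<cdot>\<^bsub>C\<^esub> i = g \<cdot>\<^bsub>C\<^esub> i \<and>
     (\<forall>x. \<forall>h \<in> hom C x (Dom C f). f \<cdot>\<^bsub>C\<^esub> h = g \<cdot>\<^bsub>C\<^esub> h \<longrightarrow> (\<exists>!k. k \<in> hom C x e \<and> i \<cdot>\<^bsub>C\<^esub> k = h))"

section \<open>Cosmoi\<close>

text \<open>\<open>Ihom y z\<close> is the internal hom \<open>[y, z]\<close> and \<open>Eval y z : [y, z] \<odot> y \<rightarrow> z\<close> its evaluation.\<close>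

record ('o, 'a) smc = "('o, 'a) cat" +
  TensO :: "'o \<Rightarrow> 'o \<Rightarrow> 'o"  (infixr "\<odot>\<index>" 70)
  TensA :: "'a \<Rightarrow> 'a \<Rightarrow> 'a"  (infixr "\<otimes>\<index>" 70)
  Unit :: "'o"
  Assoc :: "'o \<Rightarrow> 'o \<Rightarrow> 'o \<Rightarrow> 'a"
  Lunit :: "'o \<Rightarrow> 'a"
  Runit :: "'o \<Rightarrow> 'a"
  Sym :: "'o \<Rightarrow> 'o \<Rightarrow> 'a"
  Ihom :: "'o \<Rightarrow> 'o \<Rightarrow> 'o"
  Eval :: "'o \<Rightarrow> 'o \<Rightarrow> 'a"

locale monoidal_category = category V for V :: "('o, 'a) smc" (structure) +
  assumes unit_in: "Unit V \<in> Obj V"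
    and tens_in: "\<lbrakk>x \<in> Obj V; y \<in> Obj V\<rbrakk> \<Longrightarrow> x \<odot> y \<in> Obj V"
    and tens_arr: "\<lbrakk>f \<in> hom V x x'; g \<in> hom V y y'\<rbrakk> \<Longrightarrow> f \<otimes> g \<in> hom V (x \<odot> y) (x' \<odot> y')"
    and tens_idn: "\<lbrakk>x \<in> Obj V; y \<in> Obj V\<rbrakk> \<Longrightarrow> Idn V x \<otimes> Idn V y = Idn V (x \<odot> y)"
    and tens_cmp: "\<lbrakk>f \<in> hom V x x'; f' \<in> hom V x' x''; g \<in> hom V y y'; g' \<in> hom V y' y''\<rbrakk> \<Longrightarrow>
      (f' \<cdot> f) \<otimes> (g' \<cdot> g) = (f' \<otimes> g') \<cdot> (f \<otimes> g)"
    and assoc_in: "\<lbrakk>x \<in> Obj V; y \<in> Obj V; z \<in> Obj V\<rbrakk> \<Longrightarrow>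
      Assoc V x y z \<in> hom V ((x \<odot> y) \<odot> z) (x \<odot> (y \<odot> z)) \<and> iso V (Assoc V x y z)"
    and assoc_nat: "\<lbrakk>f \<in> hom V x x'; g \<in> hom V y y'; h \<in> hom V z z'\<rbrakk> \<Longrightarrow>
      Assoc V x' y' z' \<cdot> ((f \<otimes> g) \<otimes> h) = (f \<otimes> (g \<otimes> h)) \<cdot> Assoc V x y z"
    and lunit_in: "x \<in> Obj V \<Longrightarrow> Lunit V x \<in> hom V (Unit V \<odot> x) x \<and> iso V (Lunit V x)"
    and lunit_nat: "f \<in> hom V x y \<Longrightarrow> Lunit V y \<cdot> (Idn V (Unit V) \<otimes> f) = f \<cdot> Lunit V x"
    and runit_in: "x \<in> Obj V \<Longrightarrow> Runit V x \<in> hom V (x \<odot> Unit V) x \<and> iso V (Runit V x)"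
    and runit_nat: "f \<in> hom V x y \<Longrightarrow> Runit V y \<cdot> (f \<otimes> Idn V (Unit V)) = f \<cdot> Runit V x"
    and pentagon: "\<lbrakk>w \<in> Obj V; x \<in> Obj V; y \<in> Obj V; z \<in> Obj V\<rbrakk> \<Longrightarrow>
      Assoc V w x (y \<odot> z) \<cdot> Assoc V (w \<odot> x) y z
        = (Idn V w \<otimes> Assoc V x y z) \<cdot> Assoc V w (x \<odot> y) z \<cdot> (Assoc V w x y \<otimes> Idn V z)"
    and triangle: "\<lbrakk>x \<in> Obj V; y \<in> Obj V\<rbrakk> \<Longrightarrow>
      (Idn V x \<otimes> Lunit V y) \<cdot> Assoc V x (Unit V) y = Runit V x \<otimes> Idn V y"

locale symmetric_monoidal_category = monoidal_category +
  assumes sym_in: "\<lbrakk>x \<in> Obj V; y \<in> Obj V\<rbrakk> \<Longrightarrow> Sym V x y \<in> hom V (x \<odot> y) (y \<odot> x)"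
    and sym_nat: "\<lbrakk>f \<in> hom V x x'; g \<in> hom V y y'\<rbrakk> \<Longrightarrow>
      Sym V x' y' \<cdot> (f \<otimes> g) = (g \<otimes> f) \<cdot> Sym V x y"
    and sym_sym: "\<lbrakk>x \<in> Obj V; y \<in> Obj V\<rbrakk> \<Longrightarrow> Sym V y x \<cdot> Sym V x y = Idn V (x \<odot> y)"
    and hexagon: "\<lbrakk>x \<in> Obj V; y \<in> Obj V; z \<in> Obj V\<rbrakk> \<Longrightarrow>
      Assoc V y z x \<cdot> Sym V x (y \<odot> z) \<cdot> Assoc V x y z
        = (Idn V y \<otimes> Sym V x z) \<cdot> Assoc V y x z \<cdot> (Sym V x y \<otimes> Idn V z)"

locale symmetric_monoidal_closed_category = symmetric_monoidal_category +
  assumes ihom_in: "\<lbrakk>y \<in> Obj V; z \<in> Obj V\<rbrakk> \<Longrightarrow> Ihom V y z \<in> Obj V"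
    and eval_in: "\<lbrakk>y \<in> Obj V; z \<in> Obj V\<rbrakk> \<Longrightarrow> Eval V y z \<in> hom V (Ihom V y z \<odot> y) z"
    and eval_universal: "\<lbrakk>x \<in> Obj V; y \<in> Obj V; f \<in> hom V (x \<odot> y) z\<rbrakk> \<Longrightarrow>
      \<exists>!g. g \<in> hom V x (Ihom V y z) \<and> Eval V y z \<cdot> (g \<otimes> Idn V y) = f"

definition cosmos :: "'u rel \<Rightarrow> ('o, 'a) smc \<Rightarrow> bool" where
  "cosmos U V \<longleftrightarrow> symmetric_monoidal_closed_category V \<and> locally_small U V \<and>
     complete U V \<and> cocomplete U V"

definition curry_arr :: "('o, 'a) smc \<Rightarrow> 'o \<Rightarrow> 'o \<Rightarrow> 'o \<Rightarrow> 'a \<Rightarrow> 'a" where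
  "curry_arr V x y z f = (THE g. g \<in> hom V x (Ihom V y z) \<and> Eval V y z \<cdot>\<^bsub>V\<^esub> (g \<otimes>\<^bsub>V\<^esub> Idn V y) = f)"

definition name_arr :: "('o, 'a) smc \<Rightarrow> 'o \<Rightarrow> 'o \<Rightarrow> 'a \<Rightarrow> 'a" where
  "name_arr V x y f = curry_arr V (Unit V) x y (f \<cdot>\<^bsub>V\<^esub> Lunit V x)"

section \<open>Enriched categories, functors and natural transformations\<close>

record ('x, 'o, 'a) vcat =
  vOb :: "'x set"
  vHom :: "'x \<Rightarrow> 'x \<Rightarrow> 'o"
  vId :: "'x \<Rightarrow> 'a"
  vCmp :: "'x \<Rightarrow> 'x \<Rightarrow> 'x \<Rightarrow> 'a"

definition vcategory :: "('o, 'a) smc \<Rightarrow> ('x, 'o, 'a) vcat \<Rightarrow> bool" where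
  "vcategory V A \<longleftrightarrow>
     (\<forall>x \<in> vOb A. \<forall>y \<in> vOb A. vHom A x y \<in> Obj V) \<and>
     (\<forall>x \<in> vOb A. vId A x \<in> hom V (Unit V) (vHom A x x)) \<and>
     (\<forall>x \<in> vOb A. \<forall>y \<in> vOb A. \<forall>z \<in> vOb A.
        vCmp A x y z \<in> hom V (vHom A y z \<odot>\<^bsub>V\<^esub> vHom A x y) (vHom A x z)) \<and>
     (\<forall>w \<in> vOb A. \<forall>x \<in> vOb A. \<forall>y \<in> vOb A. \<forall>z \<in> vOb A.
        vCmp A w x z \<cdot>\<^bsub>V\<^esub> (vCmp A x y z \<otimes>\<^bsub>V\<^esub> Idn V (vHom A w x))
          = vCmp A w y z \<cdot>\<^bsub>V\<^esub> (Idn V (vHom A y z) \<otimes>\<^bsub>V\<^esub> vCmp A w x y)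
              \<cdot>\<^bsub>V\<^esub> Assoc V (vHom A y z) (vHom A x y) (vHom A w x)) \<and>
     (\<forall>x \<in> vOb A. \<forall>y \<in> vOb A.
        vCmp A x y y \<cdot>\<^bsub>V\<^esub> (vId A y \<otimes>\<^bsub>V\<^esub> Idn V (vHom A x y)) = Lunit V (vHom A x y) \<and>
        vCmp A x x y \<cdot>\<^bsub>V\<^esub> (Idn V (vHom A x y) \<otimes>\<^bsub>V\<^esub> vId A x) = Runit V (vHom A x y))"

definition small_vcat :: "'u rel \<Rightarrow> ('o, 'a) smc \<Rightarrow> ('x, 'o, 'a) vcat \<Rightarrow> bool" where
  "small_vcat U V A \<longleftrightarrow> vcategory V A \<and> |vOb A| <o U"

definition op_vcat :: "('o, 'a) smc \<Rightarrow> ('x, 'o, 'a) vcat \<Rightarrow> ('x, 'o, 'a) vcat" where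
  "op_vcat V A = \<lparr>vOb = vOb A, vHom = (\<lambda>x y. vHom A y x), vId = vId A,
     vCmp = (\<lambda>x y z. vCmp A z y x \<cdot>\<^bsub>V\<^esub> Sym V (vHom A z y) (vHom A y x))\<rparr>"

definition self_vcat :: "('o, 'a) smc \<Rightarrow> ('o, 'o, 'a) vcat" where
  "self_vcat V = \<lparr>vOb = Obj V, vHom = Ihom V, vId = (\<lambda>x. name_arr V x x (Idn V x)),
     vCmp = (\<lambda>x y z. curry_arr V (Ihom V y z \<odot>\<^bsub>V\<^esub> Ihom V x y) x z
        (Eval V y z \<cdot>\<^bsub>V\<^esub> (Idn V (Ihom V y z) \<otimes>\<^bsub>V\<^esub> Eval V x y)
           \<cdot>\<^bsub>V\<^esub> Assoc V (Ihom V y z) (Ihom V x y) x))\<rparr>"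

definition full_sub :: "('x, 'o, 'a) vcat \<Rightarrow> 'x set \<Rightarrow> ('x, 'o, 'a) vcat" where
  "full_sub A S = A\<lparr>vOb := S\<rparr>"

text \<open>An arrow \<open>x \<rightarrow> y\<close> of the underlying category of \<open>A\<close> is an arrow \<open>I \<rightarrow> A(x, y)\<close> of \<open>V\<close>.\<close>

definition uhom :: "('o, 'a) smc \<Rightarrow> ('x, 'o, 'a) vcat \<Rightarrow> 'x \<Rightarrow> 'x \<Rightarrow> 'a set" where
  "uhom V A x y = hom V (Unit V) (vHom A x y)"

definition ucmp :: "('o, 'a) smc \<Rightarrow> ('x, 'o, 'a) vcat \<Rightarrow> 'x \<Rightarrow> 'x \<Rightarrow> 'x \<Rightarrow> 'a \<Rightarrow> 'a \<Rightarrow> 'a" where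
  "ucmp V A x y z g f = vCmp A x y z \<cdot>\<^bsub>V\<^esub> (g \<otimes>\<^bsub>V\<^esub> f) \<cdot>\<^bsub>V\<^esub> inv_arr V (Lunit V (Unit V))"

definition uiso :: "('o, 'a) smc \<Rightarrow> ('x, 'o, 'a) vcat \<Rightarrow> 'x \<Rightarrow> 'x \<Rightarrow> bool" where
  "uiso V A x y \<longleftrightarrow> (\<exists>f \<in> uhom V A x y. \<exists>g \<in> uhom V A y x.
     ucmp V A x y x g f = vId A x \<and> ucmp V A y x y f g = vId A y)"

text \<open>The arrows \<open>A(x, g) : A(x, y) \<rightarrow> A(x, z)\<close> and \<open>A(f, z) : A(y, z) \<rightarrow> A(x, z)\<close> of \<open>V\<close>.\<close>

definition postcomp :: "('o, 'a) smc \<Rightarrow> ('x, 'o, 'a) vcat \<Rightarrow> 'x \<Rightarrow> 'x \<Rightarrow> 'x \<Rightarrow> 'a \<Rightarrow> 'a" where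
  "postcomp V A x y z g =
     vCmp A x y z \<cdot>\<^bsub>V\<^esub> (g \<otimes>\<^bsub>V\<^esub> Idn V (vHom A x y)) \<cdot>\<^bsub>V\<^esub> inv_arr V (Lunit V (vHom A x y))"

definition precomp :: "('o, 'a) smc \<Rightarrow> ('x, 'o, 'a) vcat \<Rightarrow> 'x \<Rightarrow> 'x \<Rightarrow> 'x \<Rightarrow> 'a \<Rightarrow> 'a" where
  "precomp V A x y z f =
     vCmp A x y z \<cdot>\<^bsub>V\<^esub> (Idn V (vHom A y z) \<otimes>\<^bsub>V\<^esub> f) \<cdot>\<^bsub>V\<^esub> inv_arr V (Runit V (vHom A y z))"

definition ess_small :: "'u rel \<Rightarrow> ('o, 'a) smc \<Rightarrow> ('x, 'o, 'a) vcat \<Rightarrow> bool" where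
  "ess_small U V A \<longleftrightarrow> (\<exists>S \<subseteq> vOb A. |S| <o U \<and> (\<forall>x \<in> vOb A. \<exists>y \<in> S. uiso V A x y))"

record ('x, 'y, 'a) vfun =
  fo :: "'x \<Rightarrow> 'y"
  fa :: "'x \<Rightarrow> 'x \<Rightarrow> 'a"

text \<open>Enriched functors are kept extensional (undefined off the objects of their source), so that
  functors which agree on their source are equal. This matters because they are the objects of
  presheaf categories.\<close>

definition mk_vfun :: "('x, 'o, 'a) vcat \<Rightarrow> ('x \<Rightarrow> 'y) \<Rightarrow> ('x \<Rightarrow> 'x \<Rightarrow> 'a) \<Rightarrow> ('x, 'y, 'a) vfun" where
  "mk_vfun A o' m = \<lparr>fo = restrict o' (vOb A), fa = (\<lambda>x \<in> vOb A. \<lambda>y \<in> vOb A. m x y)\<rparr>"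

definition vfunctor ::
  "('o, 'a) smc \<Rightarrow> ('x, 'o, 'a) vcat \<Rightarrow> ('y, 'o, 'a) vcat \<Rightarrow> ('x, 'y, 'a) vfun \<Rightarrow> bool" where
  "vfunctor V A B F \<longleftrightarrow> F = mk_vfun A (fo F) (fa F) \<and>
     (\<forall>x \<in> vOb A. fo F x \<in> vOb B) \<and>
     (\<forall>x \<in> vOb A. \<forall>y \<in> vOb A. fa F x y \<in> hom V (vHom A x y) (vHom B (fo F x) (fo F y))) \<and>
     (\<forall>x \<in> vOb A. fa F x x \<cdot>\<^bsub>V\<^esub> vId A x = vId B (fo F x)) \<and>
     (\<forall>x \<in> vOb A. \<forall>y \<in> vOb A. \<forall>z \<in> vOb A.
        fa F x z \<cdot>\<^bsub>V\<^esub> vCmp A x y z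
          = vCmp B (fo F x) (fo F y) (fo F z) \<cdot>\<^bsub>V\<^esub> (fa F y z \<otimes>\<^bsub>V\<^esub> fa F x y))"

definition vcompose ::
  "('o, 'a) smc \<Rightarrow> ('x, 'o, 'a) vcat \<Rightarrow> ('y, 'z, 'a) vfun \<Rightarrow> ('x, 'y, 'a) vfun \<Rightarrow> ('x, 'z, 'a) vfun"
  where
  "vcompose V A G F =
     mk_vfun A (\<lambda>x. fo G (fo F x)) (\<lambda>x y. fa G (fo F x) (fo F y) \<cdot>\<^bsub>V\<^esub> fa F x y)"

text \<open>The identity functor of \<open>A\<close>; if \<open>A\<close> is a full sub-\<open>V\<close>-category of \<open>B\<close>, this is also
  the inclusion of \<open>A\<close> into \<open>B\<close>.\<close>

definition vincl :: "('o, 'a) smc \<Rightarrow> ('x, 'o, 'a) vcat \<Rightarrow> ('x, 'x, 'a) vfun" where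
  "vincl V A = mk_vfun A (\<lambda>x. x) (\<lambda>x y. Idn V (vHom A x y))"

definition vnat ::
  "('o, 'a) smc \<Rightarrow> ('x, 'o, 'a) vcat \<Rightarrow> ('y, 'o, 'a) vcat \<Rightarrow> ('x, 'y, 'a) vfun \<Rightarrow> ('x, 'y, 'a) vfun \<Rightarrow>
   ('x \<Rightarrow> 'a) \<Rightarrow> bool" where
  "vnat V A B F G \<alpha> \<longleftrightarrow>
     (\<forall>x \<in> vOb A. \<alpha> x \<in> uhom V B (fo F x) (fo G x)) \<and>
     (\<forall>x \<in> vOb A. \<forall>y \<in> vOb A.
        postcomp V B (fo F x) (fo F y) (fo G y) (\<alpha> y) \<cdot>\<^bsub>V\<^esub> fa F x y
          = precomp V B (fo F x) (fo G x) (fo G y) (\<alpha> x) \<cdot>\<^bsub>V\<^esub> fa G x y)"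

definition vnat_invertible ::
  "('o, 'a) smc \<Rightarrow> ('x, 'o, 'a) vcat \<Rightarrow> ('y, 'o, 'a) vcat \<Rightarrow> ('x, 'y, 'a) vfun \<Rightarrow> ('x, 'y, 'a) vfun \<Rightarrow>
   ('x \<Rightarrow> 'a) \<Rightarrow> bool" where
  "vnat_invertible V A B F G \<alpha> \<longleftrightarrow> vnat V A B F G \<alpha> \<and>
     (\<exists>\<beta>. vnat V A B G F \<beta> \<and>
        (\<forall>x \<in> vOb A. ucmp V B (fo F x) (fo G x) (fo F x) (\<beta> x) (\<alpha> x) = vId B (fo F x) \<and>
                     ucmp V B (fo G x) (fo F x) (fo G x) (\<alpha> x) (\<beta> x) = vId B (fo G x)))"

text \<open>The image \<open>F f : F x \<rightarrow> F y\<close> of an arrow \<open>f : x \<rightarrow> y\<close> of the underlying category.\<close>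

definition uapp :: "('o, 'a) smc \<Rightarrow> ('x, 'y, 'a) vfun \<Rightarrow> 'x \<Rightarrow> 'x \<Rightarrow> 'a \<Rightarrow> 'a" where
  "uapp V F x y f = fa F x y \<cdot>\<^bsub>V\<^esub> f"

text \<open>Whiskering: for \<open>\<alpha> : F \<Rightarrow> G\<close>, the transformation \<open>H \<alpha> : H F \<Rightarrow> H G\<close> is \<open>whisker_left\<close>, and
  \<open>\<alpha> H : F H \<Rightarrow> G H\<close> is \<open>whisker_right\<close>.\<close>

definition whisker_left ::
  "('o, 'a) smc \<Rightarrow> ('y, 'z, 'a) vfun \<Rightarrow> ('x, 'y, 'a) vfun \<Rightarrow> ('x, 'y, 'a) vfun \<Rightarrow> ('x \<Rightarrow> 'a) \<Rightarrow> ('x \<Rightarrow> 'a)"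
  where
  "whisker_left V H F G \<alpha> = (\<lambda>x. uapp V H (fo F x) (fo G x) (\<alpha> x))"

definition whisker_right :: "('y \<Rightarrow> 'a) \<Rightarrow> ('x, 'y, 'a) vfun \<Rightarrow> ('x \<Rightarrow> 'a)" where
  "whisker_right \<alpha> H = (\<lambda>x. \<alpha> (fo H x))"

definition vertical ::
  "('o, 'a) smc \<Rightarrow> ('y, 'o, 'a) vcat \<Rightarrow> ('x, 'y, 'a) vfun \<Rightarrow> ('x, 'y, 'a) vfun \<Rightarrow> ('x, 'y, 'a) vfun \<Rightarrow>
   ('x \<Rightarrow> 'a) \<Rightarrow> ('x \<Rightarrow> 'a) \<Rightarrow> ('x \<Rightarrow> 'a)" where
  "vertical V B F G H \<beta> \<alpha> = (\<lambda>x. ucmp V B (fo F x) (fo G x) (fo H x) (\<beta> x) (\<alpha> x))"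

section \<open>Adjunctions\<close>

record ('x, 'y, 'a) vadj =
  ladj :: "('x, 'y, 'a) vfun"
  radj :: "('y, 'x, 'a) vfun"
  aunit :: "'x \<Rightarrow> 'a"
  acounit :: "'y \<Rightarrow> 'a"

definition vadjunction ::
  "('o, 'a) smc \<Rightarrow> ('x, 'o, 'a) vcat \<Rightarrow> ('y, 'o, 'a) vcat \<Rightarrow> ('x, 'y, 'a) vadj \<Rightarrow> bool" where
  "vadjunction V A B T \<longleftrightarrow> (let L = ladj T; R = radj T; \<eta> = aunit T; \<epsilon> = acounit T in
     vfunctor V A B L \<and> vfunctor V B A R \<and>
     vnat V A A (vincl V A) (vcompose V A R L) \<eta> \<and>
     vnat V B B (vcompose V B L R) (vincl V B) \<epsilon> \<and>
     (\<forall>x \<in> vOb A. ucmp V B (fo L x) (fo L (fo R (fo L x))) (fo L x)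
        (\<epsilon> (fo L x)) (uapp V L x (fo R (fo L x)) (\<eta> x)) = vId B (fo L x)) \<and>
     (\<forall>y \<in> vOb B. ucmp V A (fo R y) (fo R (fo L (fo R y))) (fo R y)
        (uapp V R (fo L (fo R y)) y (\<epsilon> y)) (\<eta> (fo R y)) = vId A (fo R y)))"

text \<open>The composite of \<open>L\<^sub>1 \<stileturn> R\<^sub>1\<close> between \<open>A\<close> and \<open>B\<close> and \<open>L\<^sub>2 \<stileturn> R\<^sub>2\<close> between \<open>B\<close> and \<open>D\<close> has
  unit \<open>R\<^sub>1 \<eta>\<^sub>2 L\<^sub>1 \<bullet> \<eta>\<^sub>1\<close> and counit \<open>\<epsilon>\<^sub>2 \<bullet> L\<^sub>2 \<epsilon>\<^sub>1 R\<^sub>2\<close>.\<close>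

definition adj_compose ::
  "('o, 'a) smc \<Rightarrow> ('x, 'o, 'a) vcat \<Rightarrow> ('y, 'o, 'a) vcat \<Rightarrow> ('z, 'o, 'a) vcat \<Rightarrow>
   ('y, 'z, 'a) vadj \<Rightarrow> ('x, 'y, 'a) vadj \<Rightarrow> ('x, 'z, 'a) vadj" where
  "adj_compose V A B D T2 T1 =
     (let L1 = ladj T1; R1 = radj T1; L2 = ladj T2; R2 = radj T2;
          L = vcompose V A L2 L1; R = vcompose V D R1 R2
      in \<lparr>ladj = L, radj = R,
          aunit = vertical V A (vincl V A) (vcompose V A R1 L1) (vcompose V A R L)
            (whisker_left V R1 L1 (vcompose V A (vcompose V B R2 L2) L1)
               (whisker_right (aunit T2) L1))
            (aunit T1),
          acounit = vertical V D (vcompose V D L R) (vcompose V D L2 R2) (vincl V D)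
            (acounit T2)
            (whisker_left V L2 (vcompose V D (vcompose V B L1 R1) R2) R2
               (whisker_right (acounit T1) R2))\<rparr>)"

section \<open>Ends, functor categories, weighted colimits\<close>

text \<open>\<open>vwedge V A D F G e p\<close>: the arrows \<open>p a : e \<rightarrow> D(F a, G a)\<close> of \<open>V\<close> are \<open>V\<close>-natural in \<open>a\<close>; the
  condition is the one that makes sense of \<open>G f \<circ> p a = p b \<circ> F f\<close> for \<open>f\<close> in \<open>A(a, b)\<close>, as an
  equation between arrows \<open>A(a, b) \<odot> e \<rightarrow> D(F a, G b)\<close>. A universal such family is the end
  of \<open>D(F -, G -)\<close>, the object of \<open>V\<close>-natural transformations.\<close>

definition vwedge ::
  "('o, 'a) smc \<Rightarrow> ('x, 'o, 'a) vcat \<Rightarrow> ('y, 'o, 'a) vcat \<Rightarrow> ('x, 'y, 'a) vfun \<Rightarrow> ('x, 'y, 'a) vfun \<Rightarrow>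
   'o \<Rightarrow> ('x \<Rightarrow> 'a) \<Rightarrow> bool" where
  "vwedge V A D F G e p \<longleftrightarrow> e \<in> Obj V \<and>
     (\<forall>a \<in> vOb A. p a \<in> hom V e (vHom D (fo F a) (fo G a))) \<and>
     (\<forall>a \<in> vOb A. \<forall>b \<in> vOb A.
        vCmp D (fo F a) (fo G a) (fo G b) \<cdot>\<^bsub>V\<^esub> (fa G a b \<otimes>\<^bsub>V\<^esub> p a)
          = vCmp D (fo F a) (fo F b) (fo G b) \<cdot>\<^bsub>V\<^esub> (p b \<otimes>\<^bsub>V\<^esub> fa F a b) \<cdot>\<^bsub>V\<^esub> Sym V (vHom A a b) e)"

definition is_end ::
  "('o, 'a) smc \<Rightarrow> ('x, 'o, 'a) vcat \<Rightarrow> ('y, 'o, 'a) vcat \<Rightarrow> ('x, 'y, 'a) vfun \<Rightarrow> ('x, 'y, 'a) vfun \<Rightarrow>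
   'o \<Rightarrow> ('x \<Rightarrow> 'a) \<Rightarrow> bool" where
  "is_end V A D F G e p \<longleftrightarrow> vwedge V A D F G e p \<and>
     (\<forall>x q. vwedge V A D F G x q \<longrightarrow>
        (\<exists>!h. h \<in> hom V x e \<and> (\<forall>a \<in> vOb A. p a \<cdot>\<^bsub>V\<^esub> h = q a)))"

text \<open>\<open>E\<close> is the \<open>V\<close>-category \<open>[A, D]\<close>, its hom objects being ends with projections \<open>pr F G a\<close>.
  Ends are determined only up to isomorphism, so \<open>[A, D]\<close> is specified rather than constructed.\<close>

definition functor_vcat ::
  "('o, 'a) smc \<Rightarrow> ('x, 'o, 'a) vcat \<Rightarrow> ('y, 'o, 'a) vcat \<Rightarrow> (('x, 'y, 'a) vfun, 'o, 'a) vcat \<Rightarrow>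
   (('x, 'y, 'a) vfun \<Rightarrow> ('x, 'y, 'a) vfun \<Rightarrow> 'x \<Rightarrow> 'a) \<Rightarrow> bool" where
  "functor_vcat V A D E pr \<longleftrightarrow> vcategory V E \<and>
     vOb E = {F. vfunctor V A D F} \<and>
     (\<forall>F \<in> vOb E. \<forall>G \<in> vOb E. is_end V A D F G (vHom E F G) (pr F G)) \<and>
     (\<forall>F \<in> vOb E. \<forall>a \<in> vOb A. pr F F a \<cdot>\<^bsub>V\<^esub> vId E F = vId D (fo F a)) \<and>
     (\<forall>F \<in> vOb E. \<forall>G \<in> vOb E. \<forall>H \<in> vOb E. \<forall>a \<in> vOb A.
        pr F H a \<cdot>\<^bsub>V\<^esub> vCmp E F G H
          = vCmp D (fo F a) (fo G a) (fo H a) \<cdot>\<^bsub>V\<^esub> (pr G H a \<otimes>\<^bsub>V\<^esub> pr F G a))"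

definition presheaf_vcat ::
  "('o, 'a) smc \<Rightarrow> ('x, 'o, 'a) vcat \<Rightarrow> (('x, 'o, 'a) vfun, 'o, 'a) vcat \<Rightarrow>
   (('x, 'o, 'a) vfun \<Rightarrow> ('x, 'o, 'a) vfun \<Rightarrow> 'x \<Rightarrow> 'a) \<Rightarrow> bool" where
  "presheaf_vcat V A P pr \<longleftrightarrow> functor_vcat V (op_vcat V A) (self_vcat V) P pr"

text \<open>The representable functors \<open>E(d, -)\<close> on \<open>E\<close>, and the presheaf \<open>E(D -, x)\<close> on \<open>J\<close> for a
  functor \<open>D : J \<rightarrow> E\<close>.\<close>

definition hom_from :: "('o, 'a) smc \<Rightarrow> ('y, 'o, 'a) vcat \<Rightarrow> 'y \<Rightarrow> ('y, 'o, 'a) vfun" where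
  "hom_from V E d = mk_vfun E (\<lambda>x. vHom E d x)
     (\<lambda>x y. curry_arr V (vHom E x y) (vHom E d x) (vHom E d y) (vCmp E d x y))"

definition hom_to ::
  "('o, 'a) smc \<Rightarrow> ('x, 'o, 'a) vcat \<Rightarrow> ('y, 'o, 'a) vcat \<Rightarrow> ('x, 'y, 'a) vfun \<Rightarrow> 'y \<Rightarrow> ('x, 'o, 'a) vfun"
  where
  "hom_to V J E D x = mk_vfun J (\<lambda>j. vHom E (fo D j) x)
     (\<lambda>i j. curry_arr V (vHom J j i) (vHom E (fo D i) x) (vHom E (fo D j) x)
        (vCmp E (fo D j) (fo D i) x \<cdot>\<^bsub>V\<^esub> Sym V (vHom E (fo D j) (fo D i)) (vHom E (fo D i) x)
           \<cdot>\<^bsub>V\<^esub> (fa D j i \<otimes>\<^bsub>V\<^esub> Idn V (vHom E (fo D i) x))))"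

text \<open>\<open>c\<close> is the colimit of \<open>D : J \<rightarrow> E\<close> weighted by \<open>\<phi> : J\<^sup>o\<^sup>p \<rightarrow> V\<close>, with unit
  \<open>\<xi> : \<phi> \<Rightarrow> E(D -, c)\<close> (given by arrows of \<open>V\<close>): the arrows \<open>E(c, x) \<rightarrow> [\<phi> j, E(D j, x)]\<close> induced
  by \<open>\<xi>\<close> exhibit \<open>E(c, x)\<close> as \<open>[J\<^sup>o\<^sup>p, V](\<phi>, E(D -, x))\<close>.\<close>

definition is_wcolim ::
  "('o, 'a) smc \<Rightarrow> ('x, 'o, 'a) vcat \<Rightarrow> ('y, 'o, 'a) vcat \<Rightarrow> ('x, 'o, 'a) vfun \<Rightarrow> ('x, 'y, 'a) vfun \<Rightarrow>
   'y \<Rightarrow> ('x \<Rightarrow> 'a) \<Rightarrow> bool" where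
  "is_wcolim V J E \<phi> D c \<xi> \<longleftrightarrow> c \<in> vOb E \<and>
     (\<forall>j \<in> vOb J. \<xi> j \<in> hom V (fo \<phi> j) (vHom E (fo D j) c)) \<and>
     vnat V (op_vcat V J) (self_vcat V) \<phi> (hom_to V J E D c)
       (\<lambda>j. name_arr V (fo \<phi> j) (vHom E (fo D j) c) (\<xi> j)) \<and>
     (\<forall>x \<in> vOb E. is_end V (op_vcat V J) (self_vcat V) \<phi> (hom_to V J E D x) (vHom E c x)
       (\<lambda>j. curry_arr V (vHom E c x) (fo \<phi> j) (vHom E (fo D j) x)
          (vCmp E (fo D j) c x \<cdot>\<^bsub>V\<^esub> (Idn V (vHom E c x) \<otimes>\<^bsub>V\<^esub> \<xi> j))))"

text \<open>Preservation of all small weighted colimits. As for ordinary limits, small index categories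
  may be taken with objects in the type carrying \<open>U\<close>.\<close>

definition cocontinuous ::
  "'u rel \<Rightarrow> ('o, 'a) smc \<Rightarrow> ('x, 'o, 'a) vcat \<Rightarrow> ('y, 'o, 'a) vcat \<Rightarrow> ('x, 'y, 'a) vfun \<Rightarrow> bool" where
  "cocontinuous U V E E' H \<longleftrightarrow> vfunctor V E E' H \<and>
     (\<forall>(J :: ('u, 'o, 'a) vcat) \<phi> D c \<xi>.
        small_vcat U V J \<and> vfunctor V (op_vcat V J) (self_vcat V) \<phi> \<and> vfunctor V J E D \<and>
        is_wcolim V J E \<phi> D c \<xi> \<longrightarrow>
        is_wcolim V J E' \<phi> (vcompose V J H D) (fo H c) (\<lambda>j. fa H (fo D j) c \<cdot>\<^bsub>V\<^esub> \<xi> j))"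

text \<open>The objects of the Cauchy completion, for \<open>P\<close> a category of presheaves.\<close>

definition cauchy_objects :: "'u rel \<Rightarrow> ('o, 'a) smc \<Rightarrow> ('x, 'o, 'a) vcat \<Rightarrow> 'x set" where
  "cauchy_objects U V P = {F \<in> vOb P. cocontinuous U V P (self_vcat V) (hom_from V P F)}"

text \<open>For \<open>T : A \<rightarrow> E\<close>, the functor \<open>E \<rightarrow> P A\<close> sending \<open>x\<close> to \<open>E(T -, x)\<close>. The Yoneda embedding is
  the case where \<open>T\<close> is the identity.\<close>

definition nerve ::
  "('o, 'a) smc \<Rightarrow> ('x, 'o, 'a) vcat \<Rightarrow> ('y, 'o, 'a) vcat \<Rightarrow> ('x, 'y, 'a) vfun \<Rightarrow>
   (('x, 'o, 'a) vfun, 'o, 'a) vcat \<Rightarrow> (('x, 'o, 'a) vfun \<Rightarrow> ('x, 'o, 'a) vfun \<Rightarrow> 'x \<Rightarrow> 'a) \<Rightarrow>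
   ('y, ('x, 'o, 'a) vfun, 'a) vfun" where
  "nerve V A E T P pr = mk_vfun E (\<lambda>x. hom_to V A E T x)
     (\<lambda>x y. THE h. h \<in> hom V (vHom E x y) (vHom P (hom_to V A E T x) (hom_to V A E T y)) \<and>
        (\<forall>a \<in> vOb A. pr (hom_to V A E T x) (hom_to V A E T y) a \<cdot>\<^bsub>V\<^esub> h
           = curry_arr V (vHom E x y) (vHom E (fo T a) x) (vHom E (fo T a) y) (vCmp E (fo T a) x y)))"

definition yoneda ::
  "('o, 'a) smc \<Rightarrow> ('x, 'o, 'a) vcat \<Rightarrow>
   (('x, 'o, 'a) vfun, 'o, 'a) vcat \<Rightarrow> (('x, 'o, 'a) vfun \<Rightarrow> ('x, 'o, 'a) vfun \<Rightarrow> 'x \<Rightarrow> 'a) \<Rightarrow>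
   ('x, ('x, 'o, 'a) vfun, 'a) vfun" where
  "yoneda V A P pr = nerve V A A (vincl V A) P pr"

text \<open>\<open>L : M \<rightarrow> E\<close> with unit \<open>\<kappa> : T \<Rightarrow> L S\<close> is the (pointwise) left Kan extension of \<open>T : A \<rightarrow> E\<close>
  along \<open>S : A \<rightarrow> M\<close>: each \<open>L m\<close> is the colimit of \<open>T\<close> weighted by \<open>M(S -, m)\<close>, with unit
  \<open>M(S a, m) \<rightarrow> E(L S a, L m) \<rightarrow> E(T a, L m)\<close> given by \<open>L\<close> and \<open>\<kappa>\<close>.\<close>

definition is_left_kan ::
  "('o, 'a) smc \<Rightarrow> ('x, 'o, 'a) vcat \<Rightarrow> ('m, 'o, 'a) vcat \<Rightarrow> ('y, 'o, 'a) vcat \<Rightarrow>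
   ('x, 'm, 'a) vfun \<Rightarrow> ('x, 'y, 'a) vfun \<Rightarrow> ('m, 'y, 'a) vfun \<Rightarrow> ('x \<Rightarrow> 'a) \<Rightarrow> bool" where
  "is_left_kan V A M E S T L \<kappa> \<longleftrightarrow> vfunctor V M E L \<and>
     vnat V A E T (vcompose V A L S) \<kappa> \<and>
     (\<forall>m \<in> vOb M. is_wcolim V A E (hom_to V A M S m) T (fo L m)
        (\<lambda>a. precomp V E (fo T a) (fo L (fo S a)) (fo L m) (\<kappa> a) \<cdot>\<^bsub>V\<^esub> fa L (fo S a) m))"

section \<open>Comonads and comodules\<close>

record ('x, 'a) vcomonad =
  cfun :: "('x, 'x, 'a) vfun"
  cdelta :: "'x \<Rightarrow> 'a"
  ceps :: "'x \<Rightarrow> 'a"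

definition vcomonad :: "('o, 'a) smc \<Rightarrow> ('x, 'o, 'a) vcat \<Rightarrow> ('x, 'a) vcomonad \<Rightarrow> bool" where
  "vcomonad V E C \<longleftrightarrow> (let c = cfun C; \<delta> = cdelta C; \<epsilon> = ceps C in
     vfunctor V E E c \<and>
     vnat V E E c (vcompose V E c c) \<delta> \<and>
     vnat V E E c (vincl V E) \<epsilon> \<and>
     (\<forall>x \<in> vOb E. let y = fo c x; z = fo c y in
        ucmp V E y z (fo c z) (uapp V c y z (\<delta> x)) (\<delta> x) = ucmp V E y z (fo c z) (\<delta> y) (\<delta> x) \<and>
        ucmp V E y z y (uapp V c y x (\<epsilon> x)) (\<delta> x) = vId E y \<and>
        ucmp V E y z y (\<epsilon> y) (\<delta> x) = vId E y))"

definition comodules :: "('o, 'a) smc \<Rightarrow> ('x, 'o, 'a) vcat \<Rightarrow> ('x, 'a) vcomonad \<Rightarrow> ('x \<times> 'a) set" where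
  "comodules V E C = {(m, r). let c = cfun C in m \<in> vOb E \<and> r \<in> uhom V E m (fo c m) \<and>
     ucmp V E m (fo c m) m (ceps C m) r = vId E m \<and>
     ucmp V E m (fo c m) (fo c (fo c m)) (cdelta C m) r
       = ucmp V E m (fo c m) (fo c (fo c m)) (uapp V c m (fo c m) r) r}"

text \<open>\<open>Q\<close> is the \<open>V\<close>-category \<open>E\<^sub>C\<close> of \<open>C\<close>-comodules: \<open>inc (m, r) (n, s)\<close> embeds its hom object
  into \<open>E(m, n)\<close> as the equalizer of \<open>f \<mapsto> s \<circ> f\<close> and \<open>f \<mapsto> C f \<circ> r\<close>. As with functor
  categories, the hom objects are determined only up to isomorphism.\<close>

definition comodule_vcat ::
  "('o, 'a) smc \<Rightarrow> ('x, 'o, 'a) vcat \<Rightarrow> ('x, 'a) vcomonad \<Rightarrow> ('x \<times> 'a, 'o, 'a) vcat \<Rightarrow>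
   ('x \<times> 'a \<Rightarrow> 'x \<times> 'a \<Rightarrow> 'a) \<Rightarrow> bool" where
  "comodule_vcat V E C Q inc \<longleftrightarrow> vcategory V Q \<and> vOb Q = comodules V E C \<and>
     (\<forall>X \<in> vOb Q. \<forall>Y \<in> vOb Q. let c = cfun C; m = fst X; r = snd X; n = fst Y; s = snd Y in
        is_equalizer V (vHom Q X Y) (inc X Y)
          (postcomp V E m n (fo c n) s)
          (precomp V E m (fo c m) (fo c n) r \<cdot>\<^bsub>V\<^esub> fa c m n)) \<and>
     (\<forall>X \<in> vOb Q. inc X X \<cdot>\<^bsub>V\<^esub> vId Q X = vId E (fst X)) \<and>
     (\<forall>X \<in> vOb Q. \<forall>Y \<in> vOb Q. \<forall>Z \<in> vOb Q.
        inc X Z \<cdot>\<^bsub>V\<^esub> vCmp Q X Y Z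
          = vCmp E (fst X) (fst Y) (fst Z) \<cdot>\<^bsub>V\<^esub> (inc Y Z \<otimes>\<^bsub>V\<^esub> inc X Y))"

definition forgetful ::
  "('x \<times> 'a, 'o, 'a) vcat \<Rightarrow> ('x \<times> 'a \<Rightarrow> 'x \<times> 'a \<Rightarrow> 'a) \<Rightarrow> ('x \<times> 'a, 'x, 'a) vfun" where
  "forgetful Q inc = mk_vfun Q fst inc"

text \<open>\<open>cofree X = (C X, \<delta>\<^sub>X)\<close>, acting on hom objects as the lift of \<open>C\<close>.\<close>

definition cofree ::
  "('o, 'a) smc \<Rightarrow> ('x, 'o, 'a) vcat \<Rightarrow> ('x, 'a) vcomonad \<Rightarrow> ('x \<times> 'a, 'o, 'a) vcat \<Rightarrow>
   ('x \<times> 'a \<Rightarrow> 'x \<times> 'a \<Rightarrow> 'a) \<Rightarrow> ('x, 'x \<times> 'a, 'a) vfun" where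
  "cofree V E C Q inc = (let W = (\<lambda>x. (fo (cfun C) x, cdelta C x)) in
     mk_vfun E W (\<lambda>x y. THE h. h \<in> hom V (vHom E x y) (vHom Q (W x) (W y)) \<and>
       inc (W x) (W y) \<cdot>\<^bsub>V\<^esub> h = fa (cfun C) x y))"

text \<open>The adjunction between the forgetful functor and \<open>cofree\<close>: the unit at a comodule \<open>(m, r)\<close> is
  \<open>r\<close>, as a morphism of comodules \<open>(m, r) \<rightarrow> (C m, \<delta>\<^sub>m)\<close>, and the counit is the counit of \<open>C\<close>.\<close>

definition cofree_adj ::
  "('o, 'a) smc \<Rightarrow> ('x, 'o, 'a) vcat \<Rightarrow> ('x, 'a) vcomonad \<Rightarrow> ('x \<times> 'a, 'o, 'a) vcat \<Rightarrow>
   ('x \<times> 'a \<Rightarrow> 'x \<times> 'a \<Rightarrow> 'a) \<Rightarrow> ('x \<times> 'a, 'x, 'a) vadj" where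
  "cofree_adj V E C Q inc = \<lparr>ladj = forgetful Q inc, radj = cofree V E C Q inc,
     aunit = (\<lambda>X. let Y = fo (cofree V E C Q inc) (fst X)
                  in THE u. u \<in> uhom V Q X Y \<and> inc X Y \<cdot>\<^bsub>V\<^esub> u = snd X),
     acounit = ceps C\<rparr>"

definition Rep ::
  "'u rel \<Rightarrow> ('o, 'a) smc \<Rightarrow> ('x, 'o, 'a) vcat \<Rightarrow> ('x \<times> 'a, 'o, 'a) vcat \<Rightarrow> ('x \<times> 'a, 'o, 'a) vcat"
  where
  "Rep U V P Q = full_sub Q {X \<in> vOb Q. fst X \<in> cauchy_objects U V P}"

section \<open>The Tannakian adjunction\<close>

text \<open>A map into \<open>B\<close> is given by an adjunction \<open>w \<stileturn> w'\<close> between \<open>P A\<close> and \<open>P = P B\<close>. The left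
  biadjoint sends it to the comonad \<open>w w'\<close> on \<open>P\<close>.\<close>

definition tannaka_L ::
  "('o, 'a) smc \<Rightarrow> ('y, 'o, 'a) vcat \<Rightarrow> ('x, 'y, 'a) vadj \<Rightarrow> ('y, 'a) vcomonad" where
  "tannaka_L V P w = \<lparr>cfun = vcompose V P (ladj w) (radj w),
     cdelta = (\<lambda>x. uapp V (ladj w) (fo (radj w) x) (fo (radj w) (fo (ladj w) (fo (radj w) x)))
                     (aunit w (fo (radj w) x))),
     ceps = acounit w\<rparr>"

text \<open>A coaction \<open>\<rho> : w \<Rightarrow> C w\<close> induces \<open>C \<epsilon> \<bullet> \<rho> w' : w w' \<Rightarrow> C\<close>.\<close>

definition coaction_mate ::
  "('o, 'a) smc \<Rightarrow> ('y, 'o, 'a) vcat \<Rightarrow> ('y, 'a) vcomonad \<Rightarrow> ('x, 'y, 'a) vadj \<Rightarrow> ('x \<Rightarrow> 'a) \<Rightarrow>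
   ('y \<Rightarrow> 'a)" where
  "coaction_mate V P C w \<rho> =
     (let ww = vcompose V P (ladj w) (radj w)
      in vertical V P ww (vcompose V P (cfun C) ww) (cfun C)
           (whisker_left V (cfun C) ww (vincl V P) (acounit w))
           (whisker_right \<rho> (radj w)))"

text \<open>The right biadjoint: \<open>v\<^sub>C = V L\<^sub>K\<close> with right adjoint \<open>K\<^sup>~ W\<close>, for \<open>AK\<close> the adjunction between
  \<open>L\<^sub>K\<close> and \<open>K\<^sup>~\<close>, and the coaction \<open>\<rho>\<^sub>C = \<rho> L\<^sub>K\<close> where \<open>\<rho>\<close> at a comodule \<open>(m, r)\<close> is \<open>r\<close>.\<close>

definition tannaka_R ::
  "('o, 'a) smc \<Rightarrow> ('x, 'o, 'a) vcat \<Rightarrow> ('x, 'a) vcomonad \<Rightarrow> ('x \<times> 'a, 'o, 'a) vcat \<Rightarrow>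
   ('x \<times> 'a \<Rightarrow> 'x \<times> 'a \<Rightarrow> 'a) \<Rightarrow> ('z, 'o, 'a) vcat \<Rightarrow> ('z, 'x \<times> 'a, 'a) vadj \<Rightarrow> ('z, 'x, 'a) vadj" where
  "tannaka_R V P C Q inc PR AK = adj_compose V PR Q P (cofree_adj V P C Q inc) AK"

definition tannaka_coaction :: "('z, 'x \<times> 'a, 'a) vadj \<Rightarrow> ('z \<Rightarrow> 'a)" where
  "tannaka_coaction AK = whisker_right snd (ladj AK)"

definition tannaka_counit ::
  "('o, 'a) smc \<Rightarrow> ('x, 'o, 'a) vcat \<Rightarrow> ('x, 'a) vcomonad \<Rightarrow> ('x \<times> 'a, 'o, 'a) vcat \<Rightarrow>
   ('x \<times> 'a \<Rightarrow> 'x \<times> 'a \<Rightarrow> 'a) \<Rightarrow> ('z, 'o, 'a) vcat \<Rightarrow> ('z, 'x \<times> 'a, 'a) vadj \<Rightarrow> ('x \<Rightarrow> 'a)" where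
  "tannaka_counit V P C Q inc PR AK =
     coaction_mate V P C (tannaka_R V P C Q inc PR AK) (tannaka_coaction AK)"

end

theory Submission
  imports Defs
begin

text \<open>By the definition of the composite adjunction, the counit of \<open>v\<^sub>C = V L\<^sub>K \<stileturn> K\<^sup>~ W\<close> at \<open>X\<close> is
  \<open>\<epsilon>\<^sub>X \<circ> f\<close>, where \<open>\<epsilon>\<close> is the counit of \<open>C\<close> and \<open>f = V \<epsilon>\<^sup>K\<^bsub>W X\<^esub>\<close>. So the counit of the Tannakian
  adjunction at \<open>X\<close> is \<open>C \<epsilon>\<^sub>X \<circ> C f \<circ> r\<close> with \<open>r\<close> the coaction of \<open>L\<^sub>K K\<^sup>~ W X\<close>. As \<open>f\<close> is a morphism
  of comodules, \<open>C f \<circ> r = \<delta>\<^sub>X \<circ> f\<close>, and \<open>C \<epsilon>\<^sub>X \<circ> \<delta>\<^sub>X\<close> is the identity, which leaves \<open>f\<close>. The statement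
  about invertibility holds because the forgetful functor from comodules reflects isomorphisms.\<close>

section \<open>Isomorphisms and unit coherence\<close>

context category
begin

lemma hom_Arr: "f \<in> hom C x y \<Longrightarrow> f \<in> Arr C"
  and hom_Dom: "f \<in> hom C x y \<Longrightarrow> Dom C f = x"
  and hom_Cod: "f \<in> hom C x y \<Longrightarrow> Cod C f = y"
  by (simp_all add: hom_def)

lemmas homD = hom_Arr hom_Dom hom_Cod

lemma hom_Obj: "f \<in> hom C x y \<Longrightarrow> x \<in> Obj C" "f \<in> hom C x y \<Longrightarrow> y \<in> Obj C"
  using dom_in cod_in by (auto simp: hom_def)

lemma Arr_hom: "f \<in> Arr C \<Longrightarrow> f \<in> hom C (Dom C f) (Cod C f)"
  by (simp add: hom_def)

lemma Idn_typed [simp]: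
  assumes "x \<in> Obj C"
  shows "Idn C x \<in> Arr C" "Dom C (Idn C x) = x" "Cod C (Idn C x) = x"
  using idn_in[OF assms] by (simp_all add: hom_def)

text \<open>Typing goes through \<open>Arr\<close>, \<open>Dom\<close> and \<open>Cod\<close> rather
  than \<open>hom\<close>: the simplifier then computes the type of a composite from its factors,
  without guessing intermediate objects.\<close>

lemma Cmp_typed [simp]:
  assumes "f \<in> Arr C" "g \<in> Arr C" "Cod C f = Dom C g"
  shows "g \<cdot> f \<in> Arr C" "Dom C (g \<cdot> f) = Dom C f" "Cod C (g \<cdot> f) = Cod C g"
  using cmp_in[of f "Dom C f" "Dom C g" g "Cod C g"] assms by (simp_all add: hom_def)

lemma Cmp_Idn [simp]:
  assumes "f \<in> Arr C"
  shows "Cod C f = y \<Longrightarrow> Idn C y \<cdot> f = f" "Dom C f = x \<Longrightarrow> f \<cdot> Idn C x = f"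
  using idn_left idn_right Arr_hom[OF assms] by auto

lemma Cmp_assoc [simp]:
  assumes "f \<in> Arr C" "g \<in> Arr C" "h \<in> Arr C" "Cod C f = Dom C g" "Cod C g = Dom C h"
  shows "(h \<cdot> g) \<cdot> f = h \<cdot> g \<cdot> f"
  using assms cmp_assoc[of f "Dom C f" "Dom C g" g "Dom C h" h "Cod C h"] by (simp add: hom_def)

text \<open>Makes the definite description in \<open>inv_arr\<close> denote an inverse whenever
  there is one.\<close>

lemma inverse_arrows_unique:
  assumes "inverse_arrows C f g" "inverse_arrows C f h"
  shows "g = h"
proof -
  have f: "f \<in> Arr C" and g: "g \<in> hom C (Cod C f) (Dom C f)" "g \<cdot> f = Idn C (Dom C f)"
    and h: "h \<in> hom C (Cod C f) (Dom C f)" "f \<cdot> h = Idn C (Cod C f)"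
    using assms by (auto simp: inverse_arrows_def)
  have "g = g \<cdot> f \<cdot> h" using g(1) h by (simp add: homD)
  also have "\<dots> = (g \<cdot> f) \<cdot> h" using f g(1) h(1) by (simp add: homD del: g(2))
  also have "\<dots> = h" using g(2) h(1) by (simp add: homD)
  finally show ?thesis .
qed

lemma inv_arr_inverse: "iso C f \<Longrightarrow> inverse_arrows C f (inv_arr C f)"
  unfolding iso_def inv_arr_def by (metis inverse_arrows_unique theI)

lemma inv_arr_typed:
  assumes "iso C f" "f \<in> hom C x y"
  shows "inv_arr C f \<in> hom C y x" "inv_arr C f \<cdot> f = Idn C x" "f \<cdot> inv_arr C f = Idn C y"
  using inv_arr_inverse[OF assms(1)] assms(2) by (auto simp: inverse_arrows_def homD)

lemma iso_cancel_left:
  assumes "iso C f" "f \<in> hom C y z" "g \<in> hom C x y" "h \<in> hom C x y" "f \<cdot> g = f \<cdot> h"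
  shows "g = h"
proof -
  note i = inv_arr_typed[OF assms(1,2)]
  have "(inv_arr C f \<cdot> f) \<cdot> g = (inv_arr C f \<cdot> f) \<cdot> h"
    using i(1) assms by (simp add: homD)
  then show ?thesis using i(2) assms(3,4) by (simp add: homD)
qed

lemma iso_cancel_right:
  assumes "iso C f" "f \<in> hom C x y" "g \<in> hom C y z" "h \<in> hom C y z" "g \<cdot> f = h \<cdot> f"
  shows "g = h"
proof -
  note i = inv_arr_typed[OF assms(1,2)]
  have "(g \<cdot> f) \<cdot> inv_arr C f = (h \<cdot> f) \<cdot> inv_arr C f"
    using assms(5) by simp
  then have "g \<cdot> f \<cdot> inv_arr C f = h \<cdot> f \<cdot> inv_arr C f"
    using i(1) assms(2-4) by (simp add: homD)
  then show ?thesis using i(3) assms(3,4) by (simp add: homD)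
qed

lemma equalizer_factor:
  assumes "is_equalizer C e i f g" "h \<in> hom C x (Dom C f)" "f \<cdot> h = g \<cdot> h"
  obtains k where "k \<in> hom C x e" "i \<cdot> k = h"
  using assms unfolding is_equalizer_def by blast

text \<open>The composite \<open>i \<cdot> k\<close> itself equalizes \<open>f\<close> and
  \<open>g\<close>, so the uniqueness half of the universal property applies to it.\<close>

lemma equalizer_monic:
  assumes "is_equalizer C e i f g" "k \<in> hom C x e" "k' \<in> hom C x e" "i \<cdot> k = i \<cdot> k'"
    and "f \<in> Arr C" "g \<in> Arr C" "Dom C g = Dom C f"
  shows "k = k'"
proof -
  have i: "i \<in> hom C e (Dom C f)" "f \<cdot> i = g \<cdot> i"
    using assms(1) by (auto simp: is_equalizer_def)
  have "f \<cdot> i \<cdot> k = (f \<cdot> i) \<cdot> k" using i(1) assms(2,5) by (simp add: homD)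
  also have "\<dots> = g \<cdot> i \<cdot> k" using i assms(2,5-7) by (simp add: homD)
  finally have "f \<cdot> i \<cdot> k = g \<cdot> i \<cdot> k" .
  moreover have "i \<cdot> k \<in> hom C x (Dom C f)" using i(1) assms(2) cmp_in by blast
  ultimately have "\<exists>!k'. k' \<in> hom C x e \<and> i \<cdot> k' = i \<cdot> k"
    using assms(1) unfolding is_equalizer_def by blast
  then show ?thesis using assms(2-4) by metis
qed

end

section \<open>Tensor calculus and coherence of the unit\<close>

context monoidal_category
begin

lemma Unit_Obj [simp]: "Unit V \<in> Obj V"
  by (rule unit_in)

lemma TensO_Obj [simp]: "\<lbrakk>x \<in> Obj V; y \<in> Obj V\<rbrakk> \<Longrightarrow> x \<odot> y \<in> Obj V"
  by (rule tens_in)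

lemma TensA_typed [simp]:
  assumes "f \<in> Arr V" "g \<in> Arr V"
  shows "f \<otimes> g \<in> Arr V" "Dom V (f \<otimes> g) = Dom V f \<odot> Dom V g" "Cod V (f \<otimes> g) = Cod V f \<odot> Cod V g"
  using tens_arr[OF Arr_hom[OF assms(1)] Arr_hom[OF assms(2)]] by (simp_all add: hom_def)

lemma Dom_Cod_Obj [simp]: "f \<in> Arr V \<Longrightarrow> Dom V f \<in> Obj V" "f \<in> Arr V \<Longrightarrow> Cod V f \<in> Obj V"
  by (rule dom_in cod_in; assumption)+

lemma TensA_Idn [simp]: "\<lbrakk>x \<in> Obj V; y \<in> Obj V\<rbrakk> \<Longrightarrow> Idn V x \<otimes> Idn V y = Idn V (x \<odot> y)"
  by (rule tens_idn)

lemma interchange [simp]: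
  assumes "f \<in> Arr V" "f' \<in> Arr V" "g \<in> Arr V" "g' \<in> Arr V"
    and "Cod V f = Dom V f'" "Cod V g = Dom V g'"
  shows "(f' \<otimes> g') \<cdot> (f \<otimes> g) = (f' \<cdot> f) \<otimes> (g' \<cdot> g)"
  using tens_cmp[of f "Dom V f" "Dom V f'" f' "Cod V f'" g "Dom V g" "Dom V g'" g' "Cod V g'"] assms
  by (simp add: hom_def)

text \<open>Right-nested composites hide the redex of \<open>interchange\<close>; the form with a
  tail \<open>h\<close> keeps simplification going in that normal form.\<close>

lemma interchange_assoc [simp]:
  assumes "f \<in> Arr V" "f' \<in> Arr V" "g \<in> Arr V" "g' \<in> Arr V" "h \<in> Arr V"
    and "Cod V f = Dom V f'" "Cod V g = Dom V g'" "Cod V h = Dom V f \<odot> Dom V g"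
  shows "(f' \<otimes> g') \<cdot> (f \<otimes> g) \<cdot> h = ((f' \<cdot> f) \<otimes> (g' \<cdot> g)) \<cdot> h"
  using assms by (simp flip: Cmp_assoc)

lemma Assoc_typed [simp]:
  assumes "x \<in> Obj V" "y \<in> Obj V" "z \<in> Obj V"
  shows "Assoc V x y z \<in> Arr V" "Dom V (Assoc V x y z) = (x \<odot> y) \<odot> z"
    "Cod V (Assoc V x y z) = x \<odot> (y \<odot> z)" "iso V (Assoc V x y z)"
  using assoc_in[OF assms] by (simp_all add: hom_def)

lemma Lunit_typed [simp]:
  assumes "x \<in> Obj V"
  shows "Lunit V x \<in> Arr V" "Dom V (Lunit V x) = Unit V \<odot> x" "Cod V (Lunit V x) = x" "iso V (Lunit V x)"
  using lunit_in[OF assms] by (simp_all add: hom_def)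

lemma Runit_typed [simp]:
  assumes "x \<in> Obj V"
  shows "Runit V x \<in> Arr V" "Dom V (Runit V x) = x \<odot> Unit V" "Cod V (Runit V x) = x" "iso V (Runit V x)"
  using runit_in[OF assms] by (simp_all add: hom_def)

lemma inv_Lunit [simp]:
  assumes "x \<in> Obj V"
  shows "inv_arr V (Lunit V x) \<in> Arr V" "Dom V (inv_arr V (Lunit V x)) = x"
    "Cod V (inv_arr V (Lunit V x)) = Unit V \<odot> x"
    "inv_arr V (Lunit V x) \<cdot> Lunit V x = Idn V (Unit V \<odot> x)"
    "Lunit V x \<cdot> inv_arr V (Lunit V x) = Idn V x"
  using inv_arr_typed[of "Lunit V x" "Unit V \<odot> x" x] lunit_in[OF assms] by (simp_all add: hom_def)

lemma inv_Runit [simp]: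
  assumes "x \<in> Obj V"
  shows "inv_arr V (Runit V x) \<in> Arr V" "Dom V (inv_arr V (Runit V x)) = x"
    "Cod V (inv_arr V (Runit V x)) = x \<odot> Unit V"
    "inv_arr V (Runit V x) \<cdot> Runit V x = Idn V (x \<odot> Unit V)"
    "Runit V x \<cdot> inv_arr V (Runit V x) = Idn V x"
  using inv_arr_typed[of "Runit V x" "x \<odot> Unit V" x] runit_in[OF assms] by (simp_all add: hom_def)

text \<open>Tensoring with the unit is faithful, because \<open>Lunit\<close> is natural and
  invertible.\<close>

lemma Lunit_cancel:
  assumes "f \<in> hom V x y" "g \<in> hom V x y" "Idn V (Unit V) \<otimes> f = Idn V (Unit V) \<otimes> g"
  shows "f = g"
proof (rule iso_cancel_right)
  show "f \<cdot> Lunit V x = g \<cdot> Lunit V x"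
    using lunit_nat assms by metis
  show "iso V (Lunit V x)" "Lunit V x \<in> hom V (Unit V \<odot> x) x"
    using lunit_in hom_Obj[OF assms(1)] by auto
qed (use assms in auto)

lemma Runit_cancel:
  assumes "f \<in> hom V x y" "g \<in> hom V x y" "f \<otimes> Idn V (Unit V) = g \<otimes> Idn V (Unit V)"
  shows "f = g"
proof (rule iso_cancel_right)
  show "f \<cdot> Runit V x = g \<cdot> Runit V x"
    using runit_nat assms by metis
  show "iso V (Runit V x)" "Runit V x \<in> hom V (x \<odot> Unit V) x"
    using runit_in hom_Obj[OF assms(1)] by auto
qed (use assms in auto)

text \<open>Naturality of \<open>Lunit\<close> at the arrow \<open>Lunit V x\<close> itself, with
  the invertible outer \<open>Lunit V x\<close> cancelled.\<close>

lemma Lunit_Unit_tensor: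
  assumes "x \<in> Obj V"
  shows "Lunit V (Unit V \<odot> x) = Idn V (Unit V) \<otimes> Lunit V x"
proof (rule iso_cancel_left)
  show "Lunit V x \<cdot> Lunit V (Unit V \<odot> x) = Lunit V x \<cdot> (Idn V (Unit V) \<otimes> Lunit V x)"
    using lunit_nat[of "Lunit V x" "Unit V \<odot> x" x] lunit_in[OF assms] by simp
  show "Lunit V x \<in> hom V (Unit V \<odot> x) x" "iso V (Lunit V x)"
    using lunit_in[OF assms] by auto
  show "Lunit V (Unit V \<odot> x) \<in> hom V (Unit V \<odot> (Unit V \<odot> x)) (Unit V \<odot> x)"
    "Idn V (Unit V) \<otimes> Lunit V x \<in> hom V (Unit V \<odot> (Unit V \<odot> x)) (Unit V \<odot> x)"
    using assms by (simp_all add: hom_def)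
qed

lemma iso_tensor_Idn:
  assumes "iso V f" "f \<in> Arr V" "x \<in> Obj V"
  shows "iso V (f \<otimes> Idn V x)"
proof -
  note i = inv_arr_typed[OF assms(1) Arr_hom[OF assms(2)]]
  have "inverse_arrows V (f \<otimes> Idn V x) (inv_arr V f \<otimes> Idn V x)"
    using i assms by (simp add: inverse_arrows_def hom_def)
  then show ?thesis by (auto simp: iso_def)
qed

text \<open>The next two lemmas are Kelly's: the axioms relating the unit isomorphisms to each other
  follow from the pentagon and the triangle.\<close>

lemma Lunit_tensor:
  assumes [simp]: "x \<in> Obj V" "y \<in> Obj V"
  shows "Lunit V (x \<odot> y) \<cdot> Assoc V (Unit V) x y = Lunit V x \<otimes> Idn V y"
proof (rule Lunit_cancel)
  let ?I = "Unit V" and ?i = "Idn V (Unit V)"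
  let ?a = "Assoc V ?I (?I \<odot> x) y" and ?b = "Assoc V ?I ?I x \<otimes> Idn V y"
  show "Lunit V (x \<odot> y) \<cdot> Assoc V ?I x y \<in> hom V ((?I \<odot> x) \<odot> y) (x \<odot> y)"
    "Lunit V x \<otimes> Idn V y \<in> hom V ((?I \<odot> x) \<odot> y) (x \<odot> y)"
    by (simp_all add: hom_def)
  let ?l = "?i \<otimes> (Lunit V (x \<odot> y) \<cdot> Assoc V ?I x y)" and ?r = "?i \<otimes> (Lunit V x \<otimes> Idn V y)"
  \<comment> \<open>After tensoring with the unit and precomposing with the invertible
    \<open>?a\<close> and \<open>?b\<close>, the left side contains the three-associator path of the
    pentagon.\<close>
  have "(?l \<cdot> ?a) \<cdot> ?b = (?i \<otimes> Lunit V (x \<odot> y)) \<cdot> (?i \<otimes> Assoc V ?I x y) \<cdot> ?a \<cdot> ?b"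
    by simp
  also have "\<dots> = (?i \<otimes> Lunit V (x \<odot> y)) \<cdot> Assoc V ?I ?I (x \<odot> y) \<cdot> Assoc V (?I \<odot> ?I) x y"
    by (subst pentagon) simp_all
  also have "\<dots> = ((?i \<otimes> Lunit V (x \<odot> y)) \<cdot> Assoc V ?I ?I (x \<odot> y)) \<cdot> Assoc V (?I \<odot> ?I) x y"
    by simp
  also have "\<dots> = (Runit V ?I \<otimes> (Idn V x \<otimes> Idn V y)) \<cdot> Assoc V (?I \<odot> ?I) x y"
    by (subst triangle) simp_all
  also have "\<dots> = Assoc V ?I x y \<cdot> ((Runit V ?I \<otimes> Idn V x) \<otimes> Idn V y)"
    by (rule assoc_nat[symmetric]) (simp_all add: hom_def)
  \<comment> \<open>The triangle a second time, read backwards on the factor in \<open>x\<close>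
    alone, brings back \<open>?b\<close>.\<close>
  also have "\<dots> = Assoc V ?I x y \<cdot> ((?i \<otimes> Lunit V x) \<otimes> Idn V y) \<cdot> ?b"
    by (simp add: triangle[symmetric])
  also have "\<dots> = (Assoc V ?I x y \<cdot> ((?i \<otimes> Lunit V x) \<otimes> Idn V y)) \<cdot> ?b"
    by simp
  also have "\<dots> = (?r \<cdot> ?a) \<cdot> ?b"
    by (subst assoc_nat[of _ "?I" "?I" _ "?I \<odot> x" x _ y y]) (simp_all add: hom_def)
  finally have "(?l \<cdot> ?a) \<cdot> ?b = (?r \<cdot> ?a) \<cdot> ?b" .
  then have "?l \<cdot> ?a = ?r \<cdot> ?a"
    by (rule iso_cancel_right[rotated 4]) (simp_all add: iso_tensor_Idn hom_def)
  then show "?l = ?r"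
    by (rule iso_cancel_right[rotated 4]) (simp_all add: hom_def)
qed

lemma Runit_Unit: "Runit V (Unit V) = Lunit V (Unit V)"
proof (rule Runit_cancel)
  let ?I = "Unit V"
  show "Runit V ?I \<in> hom V (?I \<odot> ?I) ?I" "Lunit V ?I \<in> hom V (?I \<odot> ?I) ?I"
    by (simp_all add: hom_def)
  \<comment> \<open>The triangle at the unit object: tensored with the unit, \<open>Runit\<close>
    and \<open>Lunit\<close> become the same composite through
    \<open>Lunit V (?I \<odot> ?I)\<close>.\<close>
  have "Runit V ?I \<otimes> Idn V ?I = (Idn V ?I \<otimes> Lunit V ?I) \<cdot> Assoc V ?I ?I ?I"
    by (simp add: triangle)
  also have "\<dots> = Lunit V (?I \<odot> ?I) \<cdot> Assoc V ?I ?I ?I"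
    by (simp add: Lunit_Unit_tensor)
  finally show "Runit V ?I \<otimes> Idn V ?I = Lunit V ?I \<otimes> Idn V ?I"
    by (simp add: Lunit_tensor)
qed

lemma inv_Lunit_nat:
  assumes "f \<in> hom V x y"
  shows "inv_arr V (Lunit V y) \<cdot> f = (Idn V (Unit V) \<otimes> f) \<cdot> inv_arr V (Lunit V x)"
proof (rule iso_cancel_left)
  have [simp]: "f \<in> Arr V" "Dom V f = x" "Cod V f = y" "x \<in> Obj V" "y \<in> Obj V"
    using assms hom_Obj by (auto simp: homD)
  show "iso V (Lunit V y)" "Lunit V y \<in> hom V (Unit V \<odot> y) y"
    "inv_arr V (Lunit V y) \<cdot> f \<in> hom V x (Unit V \<odot> y)"
    "(Idn V (Unit V) \<otimes> f) \<cdot> inv_arr V (Lunit V x) \<in> hom V x (Unit V \<odot> y)"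
    by (simp_all add: hom_def)
  have "Lunit V y \<cdot> inv_arr V (Lunit V y) \<cdot> f = (Lunit V y \<cdot> inv_arr V (Lunit V y)) \<cdot> f"
    by (subst Cmp_assoc) simp_all
  also have "\<dots> = (f \<cdot> Lunit V x) \<cdot> inv_arr V (Lunit V x)"
    by simp
  also have "\<dots> = (Lunit V y \<cdot> (Idn V (Unit V) \<otimes> f)) \<cdot> inv_arr V (Lunit V x)"
    by (simp only: lunit_nat[OF assms])
  finally show "Lunit V y \<cdot> inv_arr V (Lunit V y) \<cdot> f
      = Lunit V y \<cdot> (Idn V (Unit V) \<otimes> f) \<cdot> inv_arr V (Lunit V x)"
    by simp
qed

lemma inv_Runit_nat:
  assumes "f \<in> hom V x y"
  shows "inv_arr V (Runit V y) \<cdot> f = (f \<otimes> Idn V (Unit V)) \<cdot> inv_arr V (Runit V x)"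
proof (rule iso_cancel_left)
  have [simp]: "f \<in> Arr V" "Dom V f = x" "Cod V f = y" "x \<in> Obj V" "y \<in> Obj V"
    using assms hom_Obj by (auto simp: homD)
  show "iso V (Runit V y)" "Runit V y \<in> hom V (y \<odot> Unit V) y"
    "inv_arr V (Runit V y) \<cdot> f \<in> hom V x (y \<odot> Unit V)"
    "(f \<otimes> Idn V (Unit V)) \<cdot> inv_arr V (Runit V x) \<in> hom V x (y \<odot> Unit V)"
    by (simp_all add: hom_def)
  have "Runit V y \<cdot> inv_arr V (Runit V y) \<cdot> f = (Runit V y \<cdot> inv_arr V (Runit V y)) \<cdot> f"
    by (subst Cmp_assoc) simp_all
  also have "\<dots> = (f \<cdot> Runit V x) \<cdot> inv_arr V (Runit V x)"
    by simp
  also have "\<dots> = (Runit V y \<cdot> (f \<otimes> Idn V (Unit V))) \<cdot> inv_arr V (Runit V x)"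
    by (simp only: runit_nat[OF assms])
  finally show "Runit V y \<cdot> inv_arr V (Runit V y) \<cdot> f
      = Runit V y \<cdot> (f \<otimes> Idn V (Unit V)) \<cdot> inv_arr V (Runit V x)"
    by simp
qed

text \<open>Needed for associativity of underlying composition, where the two bracketings split the
  unit in three in different ways. Both sides become the identity under the invertible
  \<open>Lunit\<close> at the tensor square of the unit, by \<open>Lunit_tensor\<close> and
  \<open>Lunit_Unit_tensor\<close>.\<close>

lemma Assoc_inv_Lunit_Unit:
  "Assoc V (Unit V) (Unit V) (Unit V) \<cdot> (inv_arr V (Lunit V (Unit V)) \<otimes> Idn V (Unit V))
     = Idn V (Unit V) \<otimes> inv_arr V (Lunit V (Unit V))" (is "?a \<cdot> (?l \<otimes> ?i) = _")
proof (rule iso_cancel_left)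
  let ?L = "Lunit V (Unit V \<odot> Unit V)"
  show "iso V ?L" "?L \<in> hom V (Unit V \<odot> (Unit V \<odot> Unit V)) (Unit V \<odot> Unit V)"
    "?a \<cdot> (?l \<otimes> ?i) \<in> hom V (Unit V \<odot> Unit V) (Unit V \<odot> (Unit V \<odot> Unit V))"
    "?i \<otimes> ?l \<in> hom V (Unit V \<odot> Unit V) (Unit V \<odot> (Unit V \<odot> Unit V))"
    by (simp_all add: hom_def)
  have "?L \<cdot> ?a \<cdot> (?l \<otimes> ?i) = (?L \<cdot> ?a) \<cdot> (?l \<otimes> ?i)"
    by simp
  also have "\<dots> = Idn V (Unit V \<odot> Unit V)"
    by (simp only: Lunit_tensor Unit_Obj) simp
  also have "\<dots> = ?L \<cdot> (?i \<otimes> ?l)"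
    by (simp add: Lunit_Unit_tensor)
  finally show "?L \<cdot> ?a \<cdot> (?l \<otimes> ?i) = ?L \<cdot> (?i \<otimes> ?l)" .
qed

section \<open>The underlying category of an enriched category\<close>

lemma vHom_Obj [simp]: "\<lbrakk>vcategory V A; x \<in> vOb A; y \<in> vOb A\<rbrakk> \<Longrightarrow> vHom A x y \<in> Obj V"
  by (simp add: vcategory_def)

lemma vId_uhom: "\<lbrakk>vcategory V A; x \<in> vOb A\<rbrakk> \<Longrightarrow> vId A x \<in> uhom V A x x"
  by (simp add: vcategory_def uhom_def)

lemma vCmp_typed [simp]:
  assumes "vcategory V A" "x \<in> vOb A" "y \<in> vOb A" "z \<in> vOb A"
  shows "vCmp A x y z \<in> Arr V" "Dom V (vCmp A x y z) = vHom A y z \<odot> vHom A x y"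
    "Cod V (vCmp A x y z) = vHom A x z"
  using assms by (simp_all add: vcategory_def hom_def)

lemma vCmp_assoc:
  assumes "vcategory V A" "w \<in> vOb A" "x \<in> vOb A" "y \<in> vOb A" "z \<in> vOb A"
  shows "vCmp A w x z \<cdot> (vCmp A x y z \<otimes> Idn V (vHom A w x))
    = vCmp A w y z \<cdot> (Idn V (vHom A y z) \<otimes> vCmp A w x y)
        \<cdot> Assoc V (vHom A y z) (vHom A x y) (vHom A w x)"
  using assms unfolding vcategory_def by blast

lemma vCmp_unit:
  assumes "vcategory V A" "x \<in> vOb A" "y \<in> vOb A"
  shows "vCmp A x y y \<cdot> (vId A y \<otimes> Idn V (vHom A x y)) = Lunit V (vHom A x y)"
    "vCmp A x x y \<cdot> (Idn V (vHom A x y) \<otimes> vId A x) = Runit V (vHom A x y)"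
  using assms unfolding vcategory_def by blast+

lemma uhom_typed:
  assumes "f \<in> uhom V A x y"
  shows "f \<in> Arr V" "Dom V f = Unit V" "Cod V f = vHom A x y"
  using assms by (simp_all add: uhom_def hom_def)

lemma ucmp_uhom:
  assumes "vcategory V A" "x \<in> vOb A" "y \<in> vOb A" "z \<in> vOb A"
    and "f \<in> uhom V A x y" "g \<in> uhom V A y z"
  shows "ucmp V A x y z g f \<in> uhom V A x z"
  using assms by (simp add: ucmp_def uhom_def hom_def)

lemma ucmp_assoc:
  assumes A: "vcategory V A" "w \<in> vOb A" "x \<in> vOb A" "y \<in> vOb A" "z \<in> vOb A"
    and f: "f \<in> uhom V A w x" and g: "g \<in> uhom V A x y" and h: "h \<in> uhom V A y z"
  shows "ucmp V A w x z (ucmp V A x y z h g) f = ucmp V A w y z h (ucmp V A w x y g f)"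
proof -
  let ?l = "inv_arr V (Lunit V (Unit V))" and ?i = "Idn V (Unit V)"
  note [simp] = A uhom_typed[OF f] uhom_typed[OF g] uhom_typed[OF h]
  have "ucmp V A w x z (ucmp V A x y z h g) f
      = (vCmp A w x z \<cdot> (vCmp A x y z \<otimes> Idn V (vHom A w x))) \<cdot> ((h \<otimes> g) \<otimes> f) \<cdot> (?l \<otimes> ?i) \<cdot> ?l"
    by (simp add: ucmp_def)
  also have "\<dots> = vCmp A w y z \<cdot> (Idn V (vHom A y z) \<otimes> vCmp A w x y)
        \<cdot> (Assoc V (vHom A y z) (vHom A x y) (vHom A w x) \<cdot> ((h \<otimes> g) \<otimes> f)) \<cdot> (?l \<otimes> ?i) \<cdot> ?l"
    by (subst vCmp_assoc) simp_all
  \<comment> \<open>Naturality moves the associator from the hom objects onto three copies of the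
    unit, where \<open>Assoc_inv_Lunit_Unit\<close> evaluates it.\<close>
  also have "\<dots> = vCmp A w y z \<cdot> (Idn V (vHom A y z) \<otimes> vCmp A w x y)
        \<cdot> (h \<otimes> (g \<otimes> f)) \<cdot> (Assoc V (Unit V) (Unit V) (Unit V) \<cdot> (?l \<otimes> ?i)) \<cdot> ?l"
    by (subst assoc_nat[of h "Unit V" "vHom A y z" g "Unit V" "vHom A x y" f "Unit V" "vHom A w x"])
      (simp_all add: hom_def)
  also have "\<dots> = ucmp V A w y z h (ucmp V A w x y g f)"
    by (subst Assoc_inv_Lunit_Unit) (simp add: ucmp_def)
  finally show ?thesis .
qed

lemma postcomp_typed:
  assumes "vcategory V A" "x \<in> vOb A" "y \<in> vOb A" "z \<in> vOb A" "g \<in> uhom V A y z"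
  shows "postcomp V A x y z g \<in> Arr V" "Dom V (postcomp V A x y z g) = vHom A x y"
    "Cod V (postcomp V A x y z g) = vHom A x z"
  using assms(1-4) uhom_typed[OF assms(5)] by (simp_all add: postcomp_def)

lemma precomp_typed:
  assumes "vcategory V A" "x \<in> vOb A" "y \<in> vOb A" "z \<in> vOb A" "f \<in> uhom V A x y"
  shows "precomp V A x y z f \<in> Arr V" "Dom V (precomp V A x y z f) = vHom A y z"
    "Cod V (precomp V A x y z f) = vHom A x z"
  using assms(1-4) uhom_typed[OF assms(5)] by (simp_all add: precomp_def)

text \<open>Turns identities on hom objects into identities between underlying arrows by evaluating
  at a point; it rests on naturality of the inverse left unit isomorphism.\<close>

lemma postcomp_ucmp:
  assumes A: "vcategory V A" "x \<in> vOb A" "y \<in> vOb A" "z \<in> vOb A"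
    and f: "f \<in> uhom V A x y" and g: "g \<in> uhom V A y z"
  shows "postcomp V A x y z g \<cdot> f = ucmp V A x y z g f"
proof -
  note [simp] = A uhom_typed[OF f] uhom_typed[OF g]
  have "postcomp V A x y z g \<cdot> f
      = vCmp A x y z \<cdot> (g \<otimes> Idn V (vHom A x y)) \<cdot> inv_arr V (Lunit V (vHom A x y)) \<cdot> f"
    by (simp add: postcomp_def)
  also have "\<dots> = ucmp V A x y z g f"
    by (subst inv_Lunit_nat[of f "Unit V"]) (simp_all add: ucmp_def hom_def)
  finally show ?thesis .
qed

lemma precomp_ucmp:
  assumes A: "vcategory V A" "x \<in> vOb A" "y \<in> vOb A" "z \<in> vOb A"
    and f: "f \<in> uhom V A x y" and g: "g \<in> uhom V A y z"
  shows "precomp V A x y z f \<cdot> g = ucmp V A x y z g f"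
proof -
  note [simp] = A uhom_typed[OF f] uhom_typed[OF g]
  have "precomp V A x y z f \<cdot> g
      = vCmp A x y z \<cdot> (Idn V (vHom A y z) \<otimes> f) \<cdot> inv_arr V (Runit V (vHom A y z)) \<cdot> g"
    by (simp add: precomp_def)
  \<comment> \<open>\<open>ucmp\<close> is defined with the left unit isomorphism, so
    \<open>Runit_Unit\<close> has to identify the two at the unit object.\<close>
  also have "\<dots> = ucmp V A x y z g f"
    by (subst inv_Runit_nat[of g "Unit V"]) (simp_all add: ucmp_def hom_def Runit_Unit)
  finally show ?thesis .
qed

lemma ucmp_vId:
  assumes A: "vcategory V A" "x \<in> vOb A" "y \<in> vOb A" and f: "f \<in> uhom V A x y"
  shows "ucmp V A x y y (vId A y) f = f" "ucmp V A x x y f (vId A x) = f"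
proof -
  note [simp] = A uhom_typed[OF f] uhom_typed[OF vId_uhom]
  \<comment> \<open>By the unit axiom this is \<open>Lunit\<close> after its inverse, hence the
    identity of the hom object; evaluation at \<open>f\<close> gives the unit law.\<close>
  have "postcomp V A x y y (vId A y)
      = (vCmp A x y y \<cdot> (vId A y \<otimes> Idn V (vHom A x y))) \<cdot> inv_arr V (Lunit V (vHom A x y))"
    by (simp add: postcomp_def)
  then show "ucmp V A x y y (vId A y) f = f"
    by (simp add: vCmp_unit vId_uhom f flip: postcomp_ucmp)
  have "precomp V A x x y (vId A x)
      = (vCmp A x x y \<cdot> (Idn V (vHom A x y) \<otimes> vId A x)) \<cdot> inv_arr V (Runit V (vHom A x y))"
    by (simp add: precomp_def)
  then show "ucmp V A x x y f (vId A x) = f"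
    by (simp add: vCmp_unit vId_uhom f flip: precomp_ucmp)
qed

section \<open>Enriched functors and natural transformations\<close>

lemma fo_vOb [simp]: "\<lbrakk>vfunctor V A B F; x \<in> vOb A\<rbrakk> \<Longrightarrow> fo F x \<in> vOb B"
  by (simp add: vfunctor_def)

lemma fa_typed [simp]:
  assumes "vfunctor V A B F" "x \<in> vOb A" "y \<in> vOb A"
  shows "fa F x y \<in> Arr V" "Dom V (fa F x y) = vHom A x y" "Cod V (fa F x y) = vHom B (fo F x) (fo F y)"
  using assms by (simp_all add: vfunctor_def hom_def)

lemma fa_vId: "\<lbrakk>vfunctor V A B F; x \<in> vOb A\<rbrakk> \<Longrightarrow> fa F x x \<cdot> vId A x = vId B (fo F x)"
  by (simp add: vfunctor_def)

lemma fa_vCmp: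
  "\<lbrakk>vfunctor V A B F; x \<in> vOb A; y \<in> vOb A; z \<in> vOb A\<rbrakk> \<Longrightarrow>
    fa F x z \<cdot> vCmp A x y z = vCmp B (fo F x) (fo F y) (fo F z) \<cdot> (fa F y z \<otimes> fa F x y)"
  unfolding vfunctor_def by blast

text \<open>The extensionality clause of \<open>vfunctor\<close> holds for any
  \<open>mk_vfun\<close>, since restriction is idempotent.\<close>

lemma vfunctor_mk_vfun:
  assumes "\<And>x. x \<in> vOb A \<Longrightarrow> o' x \<in> vOb B"
    and "\<And>x y. \<lbrakk>x \<in> vOb A; y \<in> vOb A\<rbrakk> \<Longrightarrow> m x y \<in> hom V (vHom A x y) (vHom B (o' x) (o' y))"
    and "\<And>x. x \<in> vOb A \<Longrightarrow> m x x \<cdot> vId A x = vId B (o' x)"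
    and "\<And>x y z. \<lbrakk>x \<in> vOb A; y \<in> vOb A; z \<in> vOb A\<rbrakk> \<Longrightarrow>
      m x z \<cdot> vCmp A x y z = vCmp B (o' x) (o' y) (o' z) \<cdot> (m y z \<otimes> m x y)"
  shows "vfunctor V A B (mk_vfun A o' m)"
  using assms by (simp add: vfunctor_def mk_vfun_def restrict_def fun_eq_iff)

lemma vfunctor_ext:
  assumes "vfunctor V A B F"
  shows "mk_vfun A (fo F) (fa F) = F"
  using assms by (simp add: vfunctor_def)

lemma vcompose_fo [simp]: "x \<in> vOb A \<Longrightarrow> fo (vcompose V A G F) x = fo G (fo F x)"
  by (simp add: vcompose_def mk_vfun_def)

lemma vcompose_fa [simp]:
  "\<lbrakk>x \<in> vOb A; y \<in> vOb A\<rbrakk> \<Longrightarrow> fa (vcompose V A G F) x y = fa G (fo F x) (fo F y) \<cdot> fa F x y"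
  by (simp add: vcompose_def mk_vfun_def)

lemma vincl_fo [simp]: "x \<in> vOb A \<Longrightarrow> fo (vincl V A) x = x"
  by (simp add: vincl_def mk_vfun_def)

lemma vincl_fa [simp]: "\<lbrakk>x \<in> vOb A; y \<in> vOb A\<rbrakk> \<Longrightarrow> fa (vincl V A) x y = Idn V (vHom A x y)"
  by (simp add: vincl_def mk_vfun_def)

lemma uapp_uhom:
  assumes "vfunctor V A B F" "x \<in> vOb A" "y \<in> vOb A" "f \<in> uhom V A x y"
  shows "uapp V F x y f \<in> uhom V B (fo F x) (fo F y)"
  using assms(1-3) uhom_typed[OF assms(4)] by (simp add: uapp_def uhom_def hom_def)

text \<open>Hom-level functoriality, used for whiskering on the left: compatibility with
  \<open>vCmp\<close> moves \<open>F\<close> inside, and naturality of the inverse unit isomorphism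
  moves \<open>fa F x y\<close> past the unit.\<close>

lemma fa_postcomp:
  assumes A: "vcategory V A" "vcategory V B" "vfunctor V A B F" "x \<in> vOb A" "y \<in> vOb A" "z \<in> vOb A"
    and g: "g \<in> uhom V A y z"
  shows "fa F x z \<cdot> postcomp V A x y z g
    = postcomp V B (fo F x) (fo F y) (fo F z) (uapp V F y z g) \<cdot> fa F x y"
proof -
  note [simp] = A fo_vOb[OF A(3)] fa_typed[OF A(3)] uhom_typed[OF g]
  let ?l = "\<lambda>x. inv_arr V (Lunit V x)"
  have "fa F x z \<cdot> postcomp V A x y z g
      = (fa F x z \<cdot> vCmp A x y z) \<cdot> (g \<otimes> Idn V (vHom A x y)) \<cdot> ?l (vHom A x y)"
    by (simp add: postcomp_def)
  also have "\<dots> = vCmp B (fo F x) (fo F y) (fo F z) \<cdot> ((fa F y z \<cdot> g) \<otimes> Idn V (vHom B (fo F x) (fo F y)))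
      \<cdot> (Idn V (Unit V) \<otimes> fa F x y) \<cdot> ?l (vHom A x y)"
    by (subst fa_vCmp[OF A(3)]) simp_all
  also have "\<dots> = vCmp B (fo F x) (fo F y) (fo F z) \<cdot> ((fa F y z \<cdot> g) \<otimes> Idn V (vHom B (fo F x) (fo F y)))
      \<cdot> ?l (vHom B (fo F x) (fo F y)) \<cdot> fa F x y"
    by (subst inv_Lunit_nat[of "fa F x y" "vHom A x y"]) (simp_all add: hom_def)
  finally show ?thesis by (simp add: postcomp_def uapp_def)
qed

lemma fa_precomp:
  assumes A: "vcategory V A" "vcategory V B" "vfunctor V A B F" "x \<in> vOb A" "y \<in> vOb A" "z \<in> vOb A"
    and f: "f \<in> uhom V A x y"
  shows "fa F x z \<cdot> precomp V A x y z f
    = precomp V B (fo F x) (fo F y) (fo F z) (uapp V F x y f) \<cdot> fa F y z"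
proof -
  note [simp] = A fo_vOb[OF A(3)] fa_typed[OF A(3)] uhom_typed[OF f]
  let ?r = "\<lambda>x. inv_arr V (Runit V x)"
  have "fa F x z \<cdot> precomp V A x y z f
      = (fa F x z \<cdot> vCmp A x y z) \<cdot> (Idn V (vHom A y z) \<otimes> f) \<cdot> ?r (vHom A y z)"
    by (simp add: precomp_def)
  also have "\<dots> = vCmp B (fo F x) (fo F y) (fo F z) \<cdot> (Idn V (vHom B (fo F y) (fo F z)) \<otimes> (fa F x y \<cdot> f))
      \<cdot> (fa F y z \<otimes> Idn V (Unit V)) \<cdot> ?r (vHom A y z)"
    by (subst fa_vCmp[OF A(3)]) simp_all
  also have "\<dots> = vCmp B (fo F x) (fo F y) (fo F z) \<cdot> (Idn V (vHom B (fo F y) (fo F z)) \<otimes> (fa F x y \<cdot> f))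
      \<cdot> ?r (vHom B (fo F y) (fo F z)) \<cdot> fa F y z"
    by (subst inv_Runit_nat[of "fa F y z" "vHom A y z"]) (simp_all add: hom_def)
  finally show ?thesis by (simp add: precomp_def uapp_def)
qed

lemma uapp_ucmp:
  assumes "vcategory V A" "vcategory V B" "vfunctor V A B F" "x \<in> vOb A" "y \<in> vOb A" "z \<in> vOb A"
    and "f \<in> uhom V A x y" "g \<in> uhom V A y z"
  shows "uapp V F x z (ucmp V A x y z g f)
    = ucmp V B (fo F x) (fo F y) (fo F z) (uapp V F y z g) (uapp V F x y f)"
proof -
  note [simp] = assms(1-6) uhom_typed[OF assms(7)] uhom_typed[OF assms(8)] fo_vOb[OF assms(3)] fa_typed[OF assms(3)]
  have "uapp V F x z (ucmp V A x y z g f) = (fa F x z \<cdot> vCmp A x y z) \<cdot> (g \<otimes> f) \<cdot> inv_arr V (Lunit V (Unit V))"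
    by (simp add: uapp_def ucmp_def)
  then show ?thesis
    by (simp add: fa_vCmp[OF assms(3)] uapp_def ucmp_def)
qed

lemma vnat_uhom: "\<lbrakk>vnat V A B F G \<alpha>; x \<in> vOb A\<rbrakk> \<Longrightarrow> \<alpha> x \<in> uhom V B (fo F x) (fo G x)"
  by (simp add: vnat_def)

lemma vnat_eq:
  "\<lbrakk>vnat V A B F G \<alpha>; x \<in> vOb A; y \<in> vOb A\<rbrakk> \<Longrightarrow>
    postcomp V B (fo F x) (fo F y) (fo G y) (\<alpha> y) \<cdot> fa F x y
      = precomp V B (fo F x) (fo G x) (fo G y) (\<alpha> x) \<cdot> fa G x y"
  unfolding vnat_def by blast

text \<open>Naturality only sees values on the source, so differently bracketed composites can be
  exchanged without first proving them equal as functors.\<close>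

lemma vnat_cong:
  assumes "vnat V A B F G \<alpha>"
    and "\<And>x. x \<in> vOb A \<Longrightarrow> fo F' x = fo F x \<and> fo G' x = fo G x"
    and "\<And>x y. \<lbrakk>x \<in> vOb A; y \<in> vOb A\<rbrakk> \<Longrightarrow> fa F' x y = fa F x y \<and> fa G' x y = fa G x y"
  shows "vnat V A B F' G' \<alpha>"
  using assms unfolding vnat_def by simp

lemma vnat_whisker_right:
  assumes "vcategory V D" "vfunctor V D A H" "vfunctor V A B F" "vfunctor V A B G"
    and \<alpha>: "vnat V A B F G \<alpha>" and B: "vcategory V B"
  shows "vnat V D B (vcompose V D F H) (vcompose V D G H) (whisker_right \<alpha> H)"
  unfolding vnat_def
proof (intro conjI ballI)
  fix x assume x: "x \<in> vOb D"
  show "whisker_right \<alpha> H x \<in> uhom V B (fo (vcompose V D F H) x) (fo (vcompose V D G H) x)"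
    using vnat_uhom[OF \<alpha>, of "fo H x"] assms x by (simp add: whisker_right_def)
next
  fix x y assume [simp]: "x \<in> vOb D" "y \<in> vOb D"
  let ?x = "fo H x" and ?y = "fo H y"
  have [simp]: "?x \<in> vOb A" "?y \<in> vOb A"
    using assms by simp_all
  note [simp] = B fo_vOb[OF assms(3)] fo_vOb[OF assms(4)] fa_typed[OF assms(2)] fa_typed[OF assms(3)]
    fa_typed[OF assms(4)] postcomp_typed precomp_typed vnat_uhom[OF \<alpha>]
  \<comment> \<open>The naturality square of \<alpha> at \<open>?x\<close> and \<open>?y\<close>,
    precomposed with the action of \<open>H\<close> on hom objects.\<close>
  have "(postcomp V B (fo F ?x) (fo F ?y) (fo G ?y) (\<alpha> ?y) \<cdot> fa F ?x ?y) \<cdot> fa H x y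
      = (precomp V B (fo F ?x) (fo G ?x) (fo G ?y) (\<alpha> ?x) \<cdot> fa G ?x ?y) \<cdot> fa H x y"
    by (subst vnat_eq[OF \<alpha>]) simp_all
  then show "postcomp V B (fo (vcompose V D F H) x) (fo (vcompose V D F H) y)
        (fo (vcompose V D G H) y) (whisker_right \<alpha> H y) \<cdot> fa (vcompose V D F H) x y
      = precomp V B (fo (vcompose V D F H) x) (fo (vcompose V D G H) x)
        (fo (vcompose V D G H) y) (whisker_right \<alpha> H x) \<cdot> fa (vcompose V D G H) x y"
    by (simp add: whisker_right_def)
qed

lemma vnat_whisker_left:
  assumes "vcategory V A" "vcategory V B" "vcategory V D"
    and F: "vfunctor V A B F" and G: "vfunctor V A B G" and H: "vfunctor V B D H"
    and \<alpha>: "vnat V A B F G \<alpha>"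
  shows "vnat V A D (vcompose V A H F) (vcompose V A H G) (whisker_left V H F G \<alpha>)"
  unfolding vnat_def
proof (intro conjI ballI)
  fix x assume x: "x \<in> vOb A"
  show "whisker_left V H F G \<alpha> x \<in> uhom V D (fo (vcompose V A H F) x) (fo (vcompose V A H G) x)"
    using uapp_uhom[OF H fo_vOb[OF F x] fo_vOb[OF G x] vnat_uhom[OF \<alpha> x]] x
    by (simp add: whisker_left_def)
next
  fix x y assume [simp]: "x \<in> vOb A" "y \<in> vOb A"
  note [simp] = assms(1-3) fo_vOb[OF F] fo_vOb[OF G] fo_vOb[OF H] fa_typed[OF F] fa_typed[OF G]
    fa_typed[OF H] postcomp_typed precomp_typed vnat_uhom[OF \<alpha>] uapp_uhom[OF H]
  \<comment> \<open>The action of \<open>H\<close> applied to the naturality square of \<alpha>;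
    \<open>fa_postcomp\<close> and \<open>fa_precomp\<close> then carry it past the
    components.\<close>
  have "(fa H (fo F x) (fo G y) \<cdot> postcomp V B (fo F x) (fo F y) (fo G y) (\<alpha> y)) \<cdot> fa F x y
      = (fa H (fo F x) (fo G y) \<cdot> precomp V B (fo F x) (fo G x) (fo G y) (\<alpha> x)) \<cdot> fa G x y"
    using vnat_eq[OF \<alpha>, of x y] by simp
  then show "postcomp V D (fo (vcompose V A H F) x) (fo (vcompose V A H F) y)
        (fo (vcompose V A H G) y) (whisker_left V H F G \<alpha> y) \<cdot> fa (vcompose V A H F) x y
      = precomp V D (fo (vcompose V A H F) x) (fo (vcompose V A H G) x)
        (fo (vcompose V A H G) y) (whisker_left V H F G \<alpha> x) \<cdot> fa (vcompose V A H G) x y"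
    by (simp add: whisker_left_def fa_postcomp[OF assms(2,3) H] fa_precomp[OF assms(2,3) H])
qed

lemma vfunctor_vcompose:
  assumes F: "vfunctor V A B F" and G: "vfunctor V B D G"
    and "vcategory V A" "vcategory V B" "vcategory V D"
  shows "vfunctor V A D (vcompose V A G F)"
  unfolding vcompose_def
proof (rule vfunctor_mk_vfun)
  note [simp] = assms(3-5) fo_vOb[OF F] fo_vOb[OF G] fa_typed[OF F] fa_typed[OF G]
    uhom_typed[OF vId_uhom]
  show "fo G (fo F x) \<in> vOb D" if "x \<in> vOb A" for x
    using that by simp
  show "fa G (fo F x) (fo F y) \<cdot> fa F x y \<in> hom V (vHom A x y) (vHom D (fo G (fo F x)) (fo G (fo F y)))"
    if "x \<in> vOb A" "y \<in> vOb A" for x y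
    using that by (simp add: hom_def)
  show "(fa G (fo F x) (fo F x) \<cdot> fa F x x) \<cdot> vId A x = vId D (fo G (fo F x))" if "x \<in> vOb A" for x
    using that by (simp add: fa_vId[OF F] fa_vId[OF G])
  show "(fa G (fo F x) (fo F z) \<cdot> fa F x z) \<cdot> vCmp A x y z
      = vCmp D (fo G (fo F x)) (fo G (fo F y)) (fo G (fo F z))
        \<cdot> ((fa G (fo F y) (fo F z) \<cdot> fa F y z) \<otimes> (fa G (fo F x) (fo F y) \<cdot> fa F x y))"
    if [simp]: "x \<in> vOb A" "y \<in> vOb A" "z \<in> vOb A" for x y z
  proof -
    have "(fa G (fo F x) (fo F z) \<cdot> fa F x z) \<cdot> vCmp A x y z
        = (fa G (fo F x) (fo F z) \<cdot> vCmp B (fo F x) (fo F y) (fo F z)) \<cdot> (fa F y z \<otimes> fa F x y)"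
      by (simp add: fa_vCmp[OF F])
    then show ?thesis by (simp add: fa_vCmp[OF G])
  qed
qed

end

section \<open>Comodules\<close>

text \<open>Comodules over an abstract base \<open>E\<close>, which becomes the category of
  presheaves \<open>PB\<close> in the theorem.\<close>

locale comonad_comodules = monoidal_category V for V :: "('o, 'a) smc" (structure) +
  fixes E :: "('x, 'o, 'a) vcat" and C :: "('x, 'a) vcomonad"
    and Q :: "('x \<times> 'a, 'o, 'a) vcat" and inc :: "'x \<times> 'a \<Rightarrow> 'x \<times> 'a \<Rightarrow> 'a"
  assumes vcategory_base: "vcategory V E"
    and comonad: "vcomonad V E C"
    and comodule_cat: "comodule_vcat V E C Q inc"
begin

abbreviation c where "c \<equiv> cfun C"
text \<open>The forgetful functor, written V in the informal statement; here \<open>V\<close> is the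
  base monoidal category.\<close>

abbreviation F where "F \<equiv> forgetful Q inc"
abbreviation W where "W \<equiv> cofree V E C Q inc"

section \<open>Comonad laws and hom objects of comodules\<close>

lemma cfun_vfunctor: "vfunctor V E E c"
  and cdelta_vnat: "vnat V E E c (vcompose V E c c) (cdelta C)"
  and ceps_vnat: "vnat V E E c (vincl V E) (ceps C)"
  using comonad by (simp_all add: vcomonad_def Let_def)

lemma comonad_laws:
  assumes "x \<in> vOb E"
  shows "ucmp V E (fo c x) (fo c (fo c x)) (fo c (fo c (fo c x))) (cdelta C (fo c x)) (cdelta C x)
      = ucmp V E (fo c x) (fo c (fo c x)) (fo c (fo c (fo c x)))
          (uapp V c (fo c x) (fo c (fo c x)) (cdelta C x)) (cdelta C x)"
    "ucmp V E (fo c x) (fo c (fo c x)) (fo c x) (uapp V c (fo c x) x (ceps C x)) (cdelta C x) = vId E (fo c x)"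
    "ucmp V E (fo c x) (fo c (fo c x)) (fo c x) (ceps C (fo c x)) (cdelta C x) = vId E (fo c x)"
  using comonad assms by (simp_all add: vcomonad_def Let_def)

lemma c_vOb: "x \<in> vOb E \<Longrightarrow> fo c x \<in> vOb E"
  using fo_vOb[OF cfun_vfunctor] .

lemma cdelta_uhom: "x \<in> vOb E \<Longrightarrow> cdelta C x \<in> uhom V E (fo c x) (fo c (fo c x))"
  and ceps_uhom: "x \<in> vOb E \<Longrightarrow> ceps C x \<in> uhom V E (fo c x) x"
  using vnat_uhom[OF cdelta_vnat] vnat_uhom[OF ceps_vnat] by fastforce+

lemma vcategory_comodules: "vcategory V Q"
  and vOb_comodules: "vOb Q = comodules V E C"
  using comodule_cat by (simp_all add: comodule_vcat_def)

lemma comodule_vOb: "X \<in> vOb Q \<Longrightarrow> fst X \<in> vOb E"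
  and comodule_coaction: "X \<in> vOb Q \<Longrightarrow> snd X \<in> uhom V E (fst X) (fo c (fst X))"
  by (auto simp: vOb_comodules comodules_def Let_def)

lemmas base_simps = vcategory_base vcategory_comodules c_vOb comodule_vOb comodule_coaction
  cdelta_uhom ceps_uhom uhom_typed[OF comodule_coaction] uhom_typed[OF cdelta_uhom]
  uhom_typed[OF ceps_uhom] fa_typed[OF cfun_vfunctor] postcomp_typed precomp_typed

lemma inc_equalizer:
  assumes "X \<in> vOb Q" "Y \<in> vOb Q"
  shows "is_equalizer V (vHom Q X Y) (inc X Y)
    (postcomp V E (fst X) (fst Y) (fo c (fst Y)) (snd Y))
    (precomp V E (fst X) (fo c (fst X)) (fo c (fst Y)) (snd X) \<cdot> fa c (fst X) (fst Y))"
  using comodule_cat assms by (simp add: comodule_vcat_def Let_def)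

lemma inc_typed [simp]:
  assumes "X \<in> vOb Q" "Y \<in> vOb Q"
  shows "inc X Y \<in> Arr V" "Dom V (inc X Y) = vHom Q X Y" "Cod V (inc X Y) = vHom E (fst X) (fst Y)"
  using inc_equalizer[OF assms] assms by (simp_all add: is_equalizer_def hom_def base_simps)

lemma inc_vId: "X \<in> vOb Q \<Longrightarrow> inc X X \<cdot> vId Q X = vId E (fst X)"
  using comodule_cat by (simp add: comodule_vcat_def)

lemma inc_vCmp:
  "\<lbrakk>X \<in> vOb Q; Y \<in> vOb Q; Z \<in> vOb Q\<rbrakk> \<Longrightarrow>
    inc X Z \<cdot> vCmp Q X Y Z = vCmp E (fst X) (fst Y) (fst Z) \<cdot> (inc Y Z \<otimes> inc X Y)"
  using comodule_cat unfolding comodule_vcat_def by blast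

text \<open>The device for descending to comodules: equations between arrows into a hom object of
  \<open>Q\<close>, and uniqueness of lifts, are checked in \<open>E\<close>.\<close>

lemma inc_monic:
  assumes "X \<in> vOb Q" "Y \<in> vOb Q" "k \<in> hom V x (vHom Q X Y)" "k' \<in> hom V x (vHom Q X Y)"
    and "inc X Y \<cdot> k = inc X Y \<cdot> k'"
  shows "k = k'"
  using equalizer_monic[OF inc_equalizer[OF assms(1,2)] assms(3-5)] assms(1,2)
  by (simp add: base_simps)

lemma inc_factor:
  assumes "X \<in> vOb Q" "Y \<in> vOb Q" "h \<in> hom V x (vHom E (fst X) (fst Y))"
    and "postcomp V E (fst X) (fst Y) (fo c (fst Y)) (snd Y) \<cdot> h
      = precomp V E (fst X) (fo c (fst X)) (fo c (fst Y)) (snd X) \<cdot> fa c (fst X) (fst Y) \<cdot> h"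
  obtains k where "k \<in> hom V x (vHom Q X Y)" "inc X Y \<cdot> k = h"
proof (rule equalizer_factor[OF inc_equalizer[OF assms(1,2)]])
  show "h \<in> hom V x (Dom V (postcomp V E (fst X) (fst Y) (fo c (fst Y)) (snd Y)))"
    using assms by (simp add: base_simps)
  show "postcomp V E (fst X) (fst Y) (fo c (fst Y)) (snd Y) \<cdot> h
    = (precomp V E (fst X) (fo c (fst X)) (fo c (fst Y)) (snd X) \<cdot> fa c (fst X) (fst Y)) \<cdot> h"
    using assms by (simp add: base_simps homD)
qed (use that in blast)

lemma inc_uhom:
  assumes "X \<in> vOb Q" "Y \<in> vOb Q" "u \<in> uhom V Q X Y"
  shows "inc X Y \<cdot> u \<in> uhom V E (fst X) (fst Y)"
  using assms(1,2) uhom_typed[OF assms(3)] by (simp add: uhom_def hom_def)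

text \<open>The equalizing property of \<open>inc X Y\<close>, evaluated at the point
  \<open>u\<close>, is the usual condition on a morphism of comodules.\<close>

lemma comodule_morphism:
  assumes X: "X \<in> vOb Q" and Y: "Y \<in> vOb Q" and u: "u \<in> uhom V Q X Y"
  shows "ucmp V E (fst X) (fst Y) (fo c (fst Y)) (snd Y) (inc X Y \<cdot> u)
    = ucmp V E (fst X) (fo c (fst X)) (fo c (fst Y)) (uapp V c (fst X) (fst Y) (inc X Y \<cdot> u)) (snd X)"
proof -
  note [simp] = X Y uhom_typed[OF u] base_simps
  let ?p = "postcomp V E (fst X) (fst Y) (fo c (fst Y)) (snd Y)"
  let ?q = "precomp V E (fst X) (fo c (fst X)) (fo c (fst Y)) (snd X)"
  have "(?p \<cdot> inc X Y) \<cdot> u = ((?q \<cdot> fa c (fst X) (fst Y)) \<cdot> inc X Y) \<cdot> u"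
    using inc_equalizer[OF X Y] by (simp add: is_equalizer_def)
  then have "?p \<cdot> (inc X Y \<cdot> u) = ?q \<cdot> uapp V c (fst X) (fst Y) (inc X Y \<cdot> u)"
    by (simp add: uapp_def)
  then show ?thesis
    using inc_uhom[OF X Y u] by (simp add: postcomp_ucmp precomp_ucmp uapp_uhom[OF cfun_vfunctor])
qed

text \<open>The usual condition says that \<open>f\<close>, as a point of the base hom object,
  equalizes the two arrows defining \<open>vHom Q X Y\<close>.\<close>

lemma comodule_morphism_lift:
  assumes X: "X \<in> vOb Q" and Y: "Y \<in> vOb Q" and f: "f \<in> uhom V E (fst X) (fst Y)"
    and eq: "ucmp V E (fst X) (fst Y) (fo c (fst Y)) (snd Y) f
      = ucmp V E (fst X) (fo c (fst X)) (fo c (fst Y)) (uapp V c (fst X) (fst Y) f) (snd X)"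
  obtains u where "u \<in> uhom V Q X Y" "inc X Y \<cdot> u = f"
proof (rule inc_factor[OF X Y f[unfolded uhom_def]])
  note [simp] = X Y f base_simps
  have "fa c (fst X) (fst Y) \<cdot> f \<in> uhom V E (fo c (fst X)) (fo c (fst Y))"
    using uapp_uhom[OF cfun_vfunctor _ _ f] by (simp add: uapp_def)
  then show "postcomp V E (fst X) (fst Y) (fo c (fst Y)) (snd Y) \<cdot> f
      = precomp V E (fst X) (fo c (fst X)) (fo c (fst Y)) (snd X) \<cdot> fa c (fst X) (fst Y) \<cdot> f"
    using eq by (simp add: postcomp_ucmp precomp_ucmp uapp_def)
qed (use that in \<open>simp add: uhom_def\<close>)

section \<open>The forgetful and cofree functors\<close>

lemma forgetful_fo [simp]: "X \<in> vOb Q \<Longrightarrow> fo F X = fst X"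
  and forgetful_fa [simp]: "\<lbrakk>X \<in> vOb Q; Y \<in> vOb Q\<rbrakk> \<Longrightarrow> fa F X Y = inc X Y"
  by (simp_all add: forgetful_def mk_vfun_def)

lemma forgetful_vfunctor: "vfunctor V Q E F"
  unfolding forgetful_def
  by (rule vfunctor_mk_vfun) (simp_all add: comodule_vOb hom_def inc_vId inc_vCmp)

text \<open>The counit axiom is the comonad law for \<epsilon> at \<open>fo c x\<close>; the law
  with \<open>c\<close> applied to \<epsilon> enters in \<open>cofree_transpose\<close>.\<close>

lemma cofree_comodule:
  assumes "x \<in> vOb E"
  shows "(fo c x, cdelta C x) \<in> vOb Q"
  using assms comonad_laws[OF assms] by (simp add: vOb_comodules comodules_def c_vOb cdelta_uhom)

lemma cofree_fo [simp]: "x \<in> vOb E \<Longrightarrow> fo W x = (fo c x, cdelta C x)"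
  by (simp add: cofree_def mk_vfun_def)

lemma cofree_fo_vOb: "x \<in> vOb E \<Longrightarrow> fo W x \<in> vOb Q"
  by (simp add: cofree_comodule)

text \<open>Justifies the definite description in \<open>cofree\<close>: naturality of \<delta> is
  exactly the condition for \<open>fa c x y\<close> to factor through the equalizer, and
  \<open>inc_monic\<close> makes the factor unique.\<close>

lemma cofree_fa:
  assumes [simp]: "x \<in> vOb E" "y \<in> vOb E"
  shows "fa W x y \<in> hom V (vHom E x y) (vHom Q (fo W x) (fo W y))"
    "inc (fo W x) (fo W y) \<cdot> fa W x y = fa c x y"
proof -
  let ?X = "fo W x" and ?Y = "fo W y"
  let ?P = "\<lambda>h. h \<in> hom V (vHom E x y) (vHom Q ?X ?Y) \<and> inc ?X ?Y \<cdot> h = fa c x y"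
  note [simp] = base_simps
  have X: "?X \<in> vOb Q" and Y: "?Y \<in> vOb Q"
    by (simp_all only: cofree_fo_vOb assms)
  obtain k where k: "k \<in> hom V (vHom E x y) (vHom Q ?X ?Y)" "inc ?X ?Y \<cdot> k = fa c x y"
  proof (rule inc_factor[OF X Y, of "fa c x y" "vHom E x y"])
    show "fa c x y \<in> hom V (vHom E x y) (vHom E (fst ?X) (fst ?Y))"
      by (simp add: hom_def)
    show "postcomp V E (fst ?X) (fst ?Y) (fo c (fst ?Y)) (snd ?Y) \<cdot> fa c x y
        = precomp V E (fst ?X) (fo c (fst ?X)) (fo c (fst ?Y)) (snd ?X) \<cdot> fa c (fst ?X) (fst ?Y) \<cdot> fa c x y"
      using vnat_eq[OF cdelta_vnat, of x y] by simp
  qed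
  have "fa W x y = (THE h. ?P h)"
    by (simp add: cofree_def mk_vfun_def Let_def)
  also have "?P (THE h. ?P h)"
    by (rule theI[of ?P k]) (use k inc_monic[OF X Y] in auto)
  finally show "fa W x y \<in> hom V (vHom E x y) (vHom Q ?X ?Y)" "inc ?X ?Y \<cdot> fa W x y = fa c x y"
    by auto
qed

text \<open>The functor laws of \<open>c\<close> descend along the monic \<open>inc\<close>.\<close>

lemma cofree_vfunctor: "vfunctor V E Q W"
proof -
  have W: "W = mk_vfun E (fo W) (fa W)"
    by (simp add: cofree_def mk_vfun_def Let_def fun_eq_iff)
  have "vfunctor V E Q (mk_vfun E (fo W) (fa W))"
  proof (rule vfunctor_mk_vfun)
    note [simp] = cofree_fo_vOb homD[OF cofree_fa(1)] cofree_fa(2) base_simps uhom_typed[OF vId_uhom]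
    \<comment> \<open>\<open>fo W x\<close> stays folded, since the typing facts are stated for it;
      only its first component is exposed.\<close>
    note [simp del] = cofree_fo
    have [simp]: "fst (fo W x) = fo c x" if "x \<in> vOb E" for x
      using that by (simp add: cofree_fo)
    have [simp]: "inc (fo W x) (fo W y) \<cdot> fa W x y \<cdot> k = fa c x y \<cdot> k"
      if "x \<in> vOb E" "y \<in> vOb E" "k \<in> Arr V" "Cod V k = vHom E x y" for x y k
      using that by (simp flip: Cmp_assoc)
    show "fo W x \<in> vOb Q" if "x \<in> vOb E" for x
      using that by simp
    show "fa W x y \<in> hom V (vHom E x y) (vHom Q (fo W x) (fo W y))"
      if "x \<in> vOb E" "y \<in> vOb E" for x y
      using that by (rule cofree_fa)
    show "fa W x x \<cdot> vId E x = vId Q (fo W x)" if [simp]: "x \<in> vOb E" for x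
    proof (rule inc_monic)
      show "inc (fo W x) (fo W x) \<cdot> fa W x x \<cdot> vId E x = inc (fo W x) (fo W x) \<cdot> vId Q (fo W x)"
        by (simp add: inc_vId fa_vId[OF cfun_vfunctor])
    qed (simp_all add: hom_def)
    show "fa W x z \<cdot> vCmp E x y z = vCmp Q (fo W x) (fo W y) (fo W z) \<cdot> (fa W y z \<otimes> fa W x y)"
      if [simp]: "x \<in> vOb E" "y \<in> vOb E" "z \<in> vOb E" for x y z
    proof (rule inc_monic)
      have "inc (fo W x) (fo W z) \<cdot> fa W x z \<cdot> vCmp E x y z
          = vCmp E (fo c x) (fo c y) (fo c z) \<cdot> (fa c y z \<otimes> fa c x y)"
        by (simp add: fa_vCmp[OF cfun_vfunctor])
      also have "\<dots> = (inc (fo W x) (fo W z) \<cdot> vCmp Q (fo W x) (fo W y) (fo W z)) \<cdot> (fa W y z \<otimes> fa W x y)"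
        by (simp add: inc_vCmp)
      finally show "inc (fo W x) (fo W z) \<cdot> fa W x z \<cdot> vCmp E x y z
          = inc (fo W x) (fo W z) \<cdot> vCmp Q (fo W x) (fo W y) (fo W z) \<cdot> (fa W y z \<otimes> fa W x y)"
        by simp
    qed (simp_all add: hom_def)
  qed
  then show ?thesis
    using W by simp
qed

text \<open>An equality and not only an isomorphism: \<open>inc\<close> after the lift is
  \<open>fa c\<close> itself, and both functors are extensional.\<close>

lemma forgetful_cofree: "vcompose V E F W = c"
proof -
  have "vcompose V E F W = mk_vfun E (fo c) (fa c)"
    using cofree_fo_vOb cofree_fa(2)
    by (simp add: vcompose_def mk_vfun_def restrict_def fun_eq_iff)
  then show ?thesis
    by (simp add: vfunctor_ext[OF cfun_vfunctor])
qed

text \<open>Transposing a comodule morphism \<open>u : X \<rightarrow> (C x, \<delta>)\<close> to \<open>\<epsilon> \<circ> u\<close> and back recovers \<open>u\<close>.\<close>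

lemma cofree_transpose:
  assumes X: "X \<in> vOb Q" and x: "x \<in> vOb E" and u: "u \<in> uhom V Q X (fo W x)"
  defines "f \<equiv> inc X (fo W x) \<cdot> u"
  shows "ucmp V E (fst X) (fo c (fst X)) (fo c x)
      (uapp V c (fst X) x (ucmp V E (fst X) (fo c x) x (ceps C x) f)) (snd X) = f"
proof -
  let ?m = "fst X" and ?y = "fo c x"
  have f: "f \<in> uhom V E ?m ?y"
    using inc_uhom[OF X cofree_fo_vOb[OF x] u] x by (simp add: f_def)
  note [simp] = X x f base_simps uapp_uhom[OF cfun_vfunctor] ucmp_uhom
  have "ucmp V E ?m (fo c ?m) ?y (uapp V c ?m x (ucmp V E ?m ?y x (ceps C x) f)) (snd X)
      = ucmp V E ?m (fo c ?m) ?y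
          (ucmp V E (fo c ?m) (fo c ?y) ?y (uapp V c ?y x (ceps C x)) (uapp V c ?m ?y f)) (snd X)"
    by (subst uapp_ucmp[OF _ _ cfun_vfunctor]) simp_all
  also have "\<dots> = ucmp V E ?m (fo c ?y) ?y (uapp V c ?y x (ceps C x))
      (ucmp V E ?m (fo c ?m) (fo c ?y) (uapp V c ?m ?y f) (snd X))"
    by (rule ucmp_assoc) simp_all
  \<comment> \<open>The target comodule is cofree, so the morphism condition for \<open>u\<close>
    trades the coaction of \<open>X\<close> for \<delta> at \<open>x\<close>.\<close>
  also have "\<dots> = ucmp V E ?m (fo c ?y) ?y (uapp V c ?y x (ceps C x)) (ucmp V E ?m ?y (fo c ?y) (cdelta C x) f)"
    using comodule_morphism[OF X cofree_fo_vOb[OF x] u] by (simp add: f_def)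
  also have "\<dots> = ucmp V E ?m ?y ?y
      (ucmp V E ?y (fo c ?y) ?y (uapp V c ?y x (ceps C x)) (cdelta C x)) f"
    by (rule ucmp_assoc[symmetric]) simp_all
  also have "\<dots> = f"
    by (simp add: comonad_laws ucmp_vId)
  finally show ?thesis .
qed

section \<open>The forgetful functor from comodules reflects isomorphisms\<close>

lemma forgetful_ucmp:
  assumes "X \<in> vOb Q" "Y \<in> vOb Q" "Z \<in> vOb Q" "u \<in> uhom V Q X Y" "v \<in> uhom V Q Y Z"
  shows "inc X Z \<cdot> ucmp V Q X Y Z v u = ucmp V E (fst X) (fst Y) (fst Z) (inc Y Z \<cdot> v) (inc X Y \<cdot> u)"
  using uapp_ucmp[OF vcategory_comodules vcategory_base forgetful_vfunctor assms] assms(1-3)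
  by (simp add: uapp_def)

text \<open>With r and s the coactions of \<open>X\<close> and \<open>Y\<close>, and f the
  underlying arrow of \<open>u\<close>: r g = (C g)(C f) r g = (C g) s f g = (C g) s, so a base
  inverse of f is again a morphism of comodules.\<close>

lemma inverse_comodule_morphism:
  assumes X: "X \<in> vOb Q" and Y: "Y \<in> vOb Q" and u: "u \<in> uhom V Q X Y"
    and g: "g \<in> uhom V E (fst Y) (fst X)"
    and gf: "ucmp V E (fst X) (fst Y) (fst X) g (inc X Y \<cdot> u) = vId E (fst X)"
    and fg: "ucmp V E (fst Y) (fst X) (fst Y) (inc X Y \<cdot> u) g = vId E (fst Y)"
  obtains v where "v \<in> uhom V Q Y X" "inc Y X \<cdot> v = g"
proof (rule comodule_morphism_lift[OF Y X g])
  let ?m = "fst X" and ?n = "fst Y" and ?f = "inc X Y \<cdot> u"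
  let ?cf = "uapp V c ?m ?n ?f" and ?cg = "uapp V c ?n ?m g"
  note [simp] = X Y g inc_uhom[OF X Y u] base_simps uapp_uhom[OF cfun_vfunctor] ucmp_uhom
  have cgf: "ucmp V E (fo c ?m) (fo c ?n) (fo c ?m) ?cg ?cf = vId E (fo c ?m)"
    using gf uapp_ucmp[OF vcategory_base vcategory_base cfun_vfunctor, of ?m ?n ?m ?f g]
    by (simp add: uapp_def fa_vId[OF cfun_vfunctor])
  have "ucmp V E ?n ?m (fo c ?m) (snd X) g
      = ucmp V E ?n ?m (fo c ?m) (ucmp V E ?m (fo c ?m) (fo c ?m)
          (ucmp V E (fo c ?m) (fo c ?n) (fo c ?m) ?cg ?cf) (snd X)) g"
    by (simp add: cgf ucmp_vId)
  also have "\<dots> = ucmp V E ?n ?m (fo c ?m) (ucmp V E ?m (fo c ?n) (fo c ?m) ?cg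
      (ucmp V E ?m (fo c ?m) (fo c ?n) ?cf (snd X))) g"
    by (subst ucmp_assoc) simp_all
  also have "\<dots> = ucmp V E ?n ?m (fo c ?m) (ucmp V E ?m (fo c ?n) (fo c ?m) ?cg
      (ucmp V E ?m ?n (fo c ?n) (snd Y) ?f)) g"
    using comodule_morphism[OF X Y u] by simp
  also have "\<dots> = ucmp V E ?n (fo c ?n) (fo c ?m) ?cg
      (ucmp V E ?n ?m (fo c ?n) (ucmp V E ?m ?n (fo c ?n) (snd Y) ?f) g)"
    by (rule ucmp_assoc) simp_all
  also have "\<dots> = ucmp V E ?n (fo c ?n) (fo c ?m) ?cg
      (ucmp V E ?n ?n (fo c ?n) (snd Y) (ucmp V E ?n ?m ?n ?f g))"
    by (subst ucmp_assoc) simp_all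
  also have "\<dots> = ucmp V E ?n (fo c ?n) (fo c ?m) ?cg (snd Y)"
    by (simp add: fg ucmp_vId)
  finally show "ucmp V E ?n ?m (fo c ?m) (snd X) g = ucmp V E ?n (fo c ?n) (fo c ?m) ?cg (snd Y)" .
qed (use that in blast)

text \<open>\<open>F\<close> sends composition with \<open>\<beta> x\<close> in \<open>Q\<close> to
  composition with its image in \<open>E\<close>, and \<open>inc\<close> is monic, so naturality
  squares may be tested in \<open>E\<close>.\<close>

lemma vnat_forgetful_reflect:
  assumes A: "vcategory V A" and G: "vfunctor V A Q G" and H: "vfunctor V A Q H"
    and \<beta>: "\<And>x. x \<in> vOb A \<Longrightarrow> \<beta> x \<in> uhom V Q (fo G x) (fo H x)"
    and nat: "vnat V A E (vcompose V A F G) (vcompose V A F H) (whisker_left V F G H \<beta>)"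
  shows "vnat V A Q G H \<beta>"
  unfolding vnat_def
proof (intro conjI ballI \<beta>)
  fix x y assume [simp]: "x \<in> vOb A" "y \<in> vOb A"
  note [simp] = A fo_vOb[OF G] fo_vOb[OF H] fa_typed[OF G] fa_typed[OF H] \<beta> base_simps inc_uhom
  let ?p = "postcomp V Q (fo G x) (fo G y) (fo H y) (\<beta> y)"
  let ?q = "precomp V Q (fo G x) (fo H x) (fo H y) (\<beta> x)"
  show "?p \<cdot> fa G x y = ?q \<cdot> fa H x y"
  proof (rule inc_monic)
    have "(inc (fo G x) (fo H y) \<cdot> ?p) \<cdot> fa G x y = (inc (fo G x) (fo H y) \<cdot> ?q) \<cdot> fa H x y"
      using vnat_eq[OF nat, of x y]
        fa_postcomp[OF vcategory_comodules vcategory_base forgetful_vfunctor, of "fo G x" "fo G y" "fo H y" "\<beta> y"]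
        fa_precomp[OF vcategory_comodules vcategory_base forgetful_vfunctor, of "fo G x" "fo H x" "fo H y" "\<beta> x"]
      by (simp add: whisker_left_def uapp_def)
    then show "inc (fo G x) (fo H y) \<cdot> ?p \<cdot> fa G x y = inc (fo G x) (fo H y) \<cdot> ?q \<cdot> fa H x y"
      by simp
  qed (simp_all add: hom_def)
qed

text \<open>The inverse only has to be lifted pointwise: the lift is natural because hom objects of
  comodules embed into those of the base.\<close>

lemma vnat_invertible_forgetful:
  assumes A: "vcategory V A" and G: "vfunctor V A Q G" and H: "vfunctor V A Q H"
    and \<alpha>: "vnat V A Q G H \<alpha>"
  shows "vnat_invertible V A E (vcompose V A F G) (vcompose V A F H) (whisker_left V F G H \<alpha>)
    \<longleftrightarrow> vnat_invertible V A Q G H \<alpha>" (is "?l \<longleftrightarrow> ?r")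
proof -
  note [simp] = fo_vOb[OF G] fo_vOb[OF H] vnat_uhom[OF \<alpha>]
  show ?thesis
  proof
    assume ?l
    then obtain \<gamma> where \<gamma>: "vnat V A E (vcompose V A F H) (vcompose V A F G) \<gamma>"
      and \<gamma>\<alpha>: "\<And>x. x \<in> vOb A \<Longrightarrow> ucmp V E (fst (fo G x)) (fst (fo H x)) (fst (fo G x)) (\<gamma> x)
          (inc (fo G x) (fo H x) \<cdot> \<alpha> x) = vId E (fst (fo G x))"
      and \<alpha>\<gamma>: "\<And>x. x \<in> vOb A \<Longrightarrow> ucmp V E (fst (fo H x)) (fst (fo G x)) (fst (fo H x))
          (inc (fo G x) (fo H x) \<cdot> \<alpha> x) (\<gamma> x) = vId E (fst (fo H x))"
      by (auto simp: vnat_invertible_def whisker_left_def uapp_def)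
    have "\<exists>v. v \<in> uhom V Q (fo H x) (fo G x) \<and> inc (fo H x) (fo G x) \<cdot> v = \<gamma> x" if "x \<in> vOb A" for x
      using inverse_comodule_morphism[of "fo G x" "fo H x" "\<alpha> x" "\<gamma> x"] vnat_uhom[OF \<gamma> that]
        \<gamma>\<alpha>[OF that] \<alpha>\<gamma>[OF that] that
      by (metis (no_types, lifting) fo_vOb[OF G] fo_vOb[OF H] vnat_uhom[OF \<alpha>] forgetful_fo vcompose_fo)
    then obtain \<beta> where \<beta>: "\<And>x. x \<in> vOb A \<Longrightarrow> \<beta> x \<in> uhom V Q (fo H x) (fo G x)"
      and inc_\<beta>: "\<And>x. x \<in> vOb A \<Longrightarrow> inc (fo H x) (fo G x) \<cdot> \<beta> x = \<gamma> x"
      by metis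
    \<comment> \<open>The image of \<open>\<beta>\<close> under \<open>F\<close> is
      \<open>\<gamma>\<close>, already natural, so naturality is reflected.\<close>
    have "vnat V A Q H G \<beta>"
    proof (rule vnat_forgetful_reflect[OF A H G \<beta>])
      show "vnat V A E (vcompose V A F H) (vcompose V A F G) (whisker_left V F H G \<beta>)"
        using \<gamma> by (simp add: vnat_def whisker_left_def uapp_def inc_\<beta>)
    qed
    \<comment> \<open>Underlying arrows are arrows out of \<open>Unit V\<close>, so the monic
      \<open>inc\<close> reflects the two inverse laws as well.\<close>
    moreover have "ucmp V Q (fo G x) (fo H x) (fo G x) (\<beta> x) (\<alpha> x) = vId Q (fo G x)" if [simp]: "x \<in> vOb A" for x
      by (rule inc_monic[of "fo G x" "fo G x" _ "Unit V"])
        (use \<gamma>\<alpha>[OF that] \<beta>[OF that] vcategory_comodules in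
          \<open>simp_all add: forgetful_ucmp inc_\<beta> inc_vId ucmp_uhom vId_uhom flip: uhom_def\<close>)
    moreover have "ucmp V Q (fo H x) (fo G x) (fo H x) (\<alpha> x) (\<beta> x) = vId Q (fo H x)" if [simp]: "x \<in> vOb A" for x
      by (rule inc_monic[of "fo H x" "fo H x" _ "Unit V"])
        (use \<alpha>\<gamma>[OF that] \<beta>[OF that] vcategory_comodules in
          \<open>simp_all add: forgetful_ucmp inc_\<beta> inc_vId ucmp_uhom vId_uhom flip: uhom_def\<close>)
    ultimately show ?r
      using \<alpha> by (auto simp: vnat_invertible_def)
  next
    assume ?r
    then obtain \<beta> where \<beta>: "vnat V A Q H G \<beta>"
      and \<beta>\<alpha>: "\<And>x. x \<in> vOb A \<Longrightarrow> ucmp V Q (fo G x) (fo H x) (fo G x) (\<beta> x) (\<alpha> x) = vId Q (fo G x)"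
      and \<alpha>\<beta>: "\<And>x. x \<in> vOb A \<Longrightarrow> ucmp V Q (fo H x) (fo G x) (fo H x) (\<alpha> x) (\<beta> x) = vId Q (fo H x)"
      by (auto simp: vnat_invertible_def)
    \<comment> \<open>The converse is formal: whiskering with \<open>F\<close> preserves naturality
      and, by \<open>forgetful_ucmp\<close>, inverses.\<close>
    note whisker = vnat_whisker_left[OF A vcategory_comodules vcategory_base _ _ forgetful_vfunctor]
    have "ucmp V E (fst (fo G x)) (fst (fo H x)) (fst (fo G x)) (inc (fo H x) (fo G x) \<cdot> \<beta> x)
          (inc (fo G x) (fo H x) \<cdot> \<alpha> x) = vId E (fst (fo G x)) \<and>
        ucmp V E (fst (fo H x)) (fst (fo G x)) (fst (fo H x)) (inc (fo G x) (fo H x) \<cdot> \<alpha> x)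
          (inc (fo H x) (fo G x) \<cdot> \<beta> x) = vId E (fst (fo H x))" if [simp]: "x \<in> vOb A" for x
      using \<beta>\<alpha>[OF that] \<alpha>\<beta>[OF that] vnat_uhom[OF \<beta> that]
      by (simp add: inc_vId flip: forgetful_ucmp)
    then show ?l
      unfolding vnat_invertible_def using whisker[OF G H \<alpha>] whisker[OF H G \<beta>]
      by (intro conjI exI[of _ "whisker_left V F H G \<beta>"] ballI)
        (simp_all add: whisker_left_def uapp_def)
  qed
qed

section \<open>The counit of the Tannakian adjunction\<close>

text \<open>In the theorem \<open>A\<close> is \<open>PR\<close> and \<open>T\<close> is
  \<open>AK\<close>, the adjunction between \<open>LK\<close> and \<open>Kt\<close>.\<close>

context
  fixes A :: "('z, 'o, 'a) vcat" and T :: "('z, 'x \<times> 'a, 'a) vadj"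
  assumes vcategory_source: "vcategory V A" and adjunction: "vadjunction V A Q T"
begin

abbreviation LRW where "LRW \<equiv> vcompose V E (ladj T) (vcompose V E (radj T) W)"
abbreviation \<epsilon>W where "\<epsilon>W \<equiv> whisker_right (acounit T) W"

lemma ladj_vfunctor: "vfunctor V A Q (ladj T)"
  and radj_vfunctor: "vfunctor V Q A (radj T)"
  and acounit_vnat: "vnat V Q Q (vcompose V Q (ladj T) (radj T)) (vincl V Q) (acounit T)"
  using adjunction by (simp_all add: vadjunction_def Let_def)

lemma LRW_vfunctor: "vfunctor V E Q LRW"
  by (intro vfunctor_vcompose[OF _ ladj_vfunctor] vfunctor_vcompose[OF cofree_vfunctor radj_vfunctor]
      vcategory_base vcategory_comodules vcategory_source)

lemma counit_cofree_vnat: "vnat V E Q LRW W \<epsilon>W"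
proof -
  have "vfunctor V Q Q (vincl V Q)"
    unfolding vincl_def
    by (rule vfunctor_mk_vfun)
      (simp_all add: vcategory_comodules hom_def uhom_typed[OF vId_uhom[OF vcategory_comodules]])
  then have "vnat V E Q (vcompose V E (vcompose V Q (ladj T) (radj T)) W) (vcompose V E (vincl V Q) W) \<epsilon>W"
    by (intro vnat_whisker_right[OF vcategory_base cofree_vfunctor _ _ acounit_vnat vcategory_comodules]
        vfunctor_vcompose[OF radj_vfunctor ladj_vfunctor] vcategory_comodules vcategory_source)
  \<comment> \<open>Whiskering yields (L R) W and 1 W; \<open>vnat_cong\<close> exchanges them for
    \<open>LRW\<close> and \<open>W\<close>.\<close>
  then show ?thesis
  proof (rule vnat_cong)
    note [simp] = cofree_fo_vOb fo_vOb[OF radj_vfunctor] fa_typed[OF radj_vfunctor]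
      fa_typed[OF ladj_vfunctor] fa_typed[OF cofree_vfunctor] vcategory_source
    note [simp del] = cofree_fo
    show "fo LRW x = fo (vcompose V E (vcompose V Q (ladj T) (radj T)) W) x \<and>
        fo W x = fo (vcompose V E (vincl V Q) W) x" if "x \<in> vOb E" for x
      using that by simp
    show "fa LRW x y = fa (vcompose V E (vcompose V Q (ladj T) (radj T)) W) x y \<and>
        fa W x y = fa (vcompose V E (vincl V Q) W) x y" if "x \<in> vOb E" "y \<in> vOb E" for x y
      using that by simp
  qed
qed

text \<open>The composite adjunction brackets the endofunctor as (F L)(R W); composition of
  extensional functors is strictly associative, which gives \<open>F\<close> after
  \<open>LRW\<close>.\<close>

lemma tannaka_comonad_cfun: "cfun (tannaka_L V E (tannaka_R V E C Q inc A T)) = vcompose V E F LRW"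
proof -
  note [simp] = cofree_fo_vOb fo_vOb[OF radj_vfunctor] fo_vOb[OF ladj_vfunctor]
    fo_vOb[OF cofree_vfunctor] fa_typed[OF radj_vfunctor] fa_typed[OF ladj_vfunctor]
    fa_typed[OF cofree_vfunctor] vcategory_source vcategory_comodules vcategory_base
  note [simp del] = cofree_fo
  have "cfun (tannaka_L V E (tannaka_R V E C Q inc A T))
      = vcompose V E (vcompose V A F (ladj T)) (vcompose V E (radj T) W)"
    by (simp add: tannaka_L_def tannaka_R_def adj_compose_def cofree_adj_def Let_def)
  also have "\<dots> = vcompose V E F LRW"
    by (simp add: vcompose_def[of V E] mk_vfun_def restrict_def fun_eq_iff)
  finally show ?thesis .
qed

text \<open>The mate of the coaction transposes the comodule morphism \<open>\<epsilon>W x\<close>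
  along the cofree adjunction and then transposes it back.\<close>

lemma tannaka_counit_eq:
  assumes x: "x \<in> vOb E"
  shows "tannaka_counit V E C Q inc A T x = whisker_left V F LRW W \<epsilon>W x"
proof -
  let ?X = "fo (ladj T) (fo (radj T) (fo W x))"
  note [simp del] = cofree_fo
  have LRW: "fo LRW x = ?X"
    using x by simp
  have W: "fo W x \<in> vOb Q" and R: "fo (radj T) (fo W x) \<in> vOb A" and X: "?X \<in> vOb Q"
    using fo_vOb[OF radj_vfunctor cofree_fo_vOb[OF x]] fo_vOb[OF LRW_vfunctor x]
    by (simp_all add: LRW cofree_fo_vOb x)
  have fstW: "fst (fo W x) = fo c x"
    using x by (simp add: cofree_fo)
  have u: "\<epsilon>W x \<in> uhom V Q ?X (fo W x)"
    using vnat_uhom[OF counit_cofree_vnat x] by (simp only: LRW)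
  \<comment> \<open>\<open>snd ?X\<close> is the value of \<open>tannaka_coaction\<close> at R W x,
    and the argument of \<open>uapp\<close> is the counit of the composite adjunction at
    \<open>x\<close>.\<close>
  have "tannaka_counit V E C Q inc A T x
      = ucmp V E (fst ?X) (fo c (fst ?X)) (fo c x)
          (uapp V c (fst ?X) x (ucmp V E (fst ?X) (fo c x) x (ceps C x) (inc ?X (fo W x) \<cdot> \<epsilon>W x))) (snd ?X)"
    using x X R W fstW
    by (simp add: tannaka_counit_def coaction_mate_def tannaka_R_def tannaka_coaction_def
        adj_compose_def cofree_adj_def vertical_def whisker_right_def whisker_left_def Let_def
        uapp_def)
  also have "\<dots> = inc ?X (fo W x) \<cdot> \<epsilon>W x"
    by (rule cofree_transpose[OF X x u])
  finally show ?thesis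
    using X W by (simp add: whisker_left_def uapp_def LRW del: vcompose_fo)
qed

end

end

section \<open>Specialization to presheaves and Cauchy comodules\<close>

theorem proposition5p5p1:
  fixes U :: "'u rel"
    and V :: "('o, 'a) smc"
    and B :: "('b, 'o, 'a) vcat"
    and PB :: "(('b, 'o, 'a) vfun, 'o, 'a) vcat"
    and C :: "(('b, 'o, 'a) vfun, 'a) vcomonad"
    and Q :: "(('b, 'o, 'a) vfun \<times> 'a, 'o, 'a) vcat"
    and PR :: "((('b, 'o, 'a) vfun \<times> 'a, 'o, 'a) vfun, 'o, 'a) vcat"
    and LK :: "((('b, 'o, 'a) vfun \<times> 'a, 'o, 'a) vfun, ('b, 'o, 'a) vfun \<times> 'a, 'a) vfun"
    and prB prR inc \<kappa> \<eta>K \<epsilon>K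
    and R K F W Kt AK LKKtW \<epsilon>KW F\<epsilon>KW
  defines "R \<equiv> Rep U V PB Q"
    and "K \<equiv> vincl V R"
    and "F \<equiv> forgetful Q inc"
    and "W \<equiv> cofree V PB C Q inc"
    and "Kt \<equiv> nerve V R Q K PR prR"
    and "AK \<equiv> \<lparr>ladj = LK, radj = Kt, aunit = \<eta>K, acounit = \<epsilon>K\<rparr>"
    and "LKKtW \<equiv> vcompose V PB LK (vcompose V PB Kt W)"
    and "\<epsilon>KW \<equiv> whisker_right \<epsilon>K W"
    and "F\<epsilon>KW \<equiv> whisker_left V F LKKtW W \<epsilon>KW"
  assumes "universe U" and "cosmos U V"
    and "small_vcat U V B"
    and "presheaf_vcat V B PB prB"
    and "ess_small U V (full_sub PB (cauchy_objects U V PB))"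
    and "vcomonad V PB C" and "cocontinuous U V PB PB (cfun C)"
    and "comodule_vcat V PB C Q inc"
    and "presheaf_vcat V R PR prR"
    and "is_left_kan V R PR Q (yoneda V R PR prR) K LK \<kappa>"
    and "vadjunction V PR Q AK"
  shows "vcompose V PB F W = cfun C
    \<and> vnat V PB PB (cfun (tannaka_L V PB (tannaka_R V PB C Q inc PR AK))) (cfun C) F\<epsilon>KW
    \<and> (\<forall>X \<in> vOb PB. tannaka_counit V PB C Q inc PR AK X = F\<epsilon>KW X)
    \<and> (vnat_invertible V PB PB (cfun (tannaka_L V PB (tannaka_R V PB C Q inc PR AK))) (cfun C)
         F\<epsilon>KW
       \<longleftrightarrow> vnat_invertible V PB Q LKKtW W \<epsilon>KW)"
proof -
  have V: "monoidal_category V"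
    using \<open>cosmos U V\<close> unfolding cosmos_def symmetric_monoidal_closed_category_def
      symmetric_monoidal_category_def by blast
  have PB: "vcategory V PB" and PR: "vcategory V PR"
    using \<open>presheaf_vcat V B PB prB\<close> \<open>presheaf_vcat V R PR prR\<close>
    by (simp_all add: presheaf_vcat_def functor_vcat_def)
  interpret T: comonad_comodules V PB C Q inc
    using V PB \<open>vcomonad V PB C\<close> \<open>comodule_vcat V PB C Q inc\<close>
    by (simp add: comonad_comodules_def comonad_comodules_axioms_def)
  note adj = PR \<open>vadjunction V PR Q AK\<close>
  have FW: "vcompose V PB F W = cfun C"
    unfolding F_def W_def by (rule T.forgetful_cofree)
  \<comment> \<open>These identify \<open>LKKtW\<close> and \<open>\<epsilon>KW\<close> with
    \<open>LRW\<close> and \<open>\<epsilon>W\<close> of the general context, for the adjunction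
    \<open>AK\<close>.\<close>
  have LKKtW: "LKKtW = vcompose V PB (ladj AK) (vcompose V PB (radj AK) W)"
    and \<epsilon>KW: "\<epsilon>KW = whisker_right (acounit AK) W"
    by (simp_all add: LKKtW_def \<epsilon>KW_def AK_def)
  have LKKtW_vfunctor: "vfunctor V PB Q LKKtW"
    and \<epsilon>KW_vnat: "vnat V PB Q LKKtW W \<epsilon>KW"
    and cfun_eq: "cfun (tannaka_L V PB (tannaka_R V PB C Q inc PR AK)) = vcompose V PB F LKKtW"
    and counit: "\<forall>X \<in> vOb PB. tannaka_counit V PB C Q inc PR AK X = F\<epsilon>KW X"
    using T.LRW_vfunctor[OF adj] T.counit_cofree_vnat[OF adj] T.tannaka_comonad_cfun[OF adj]
      T.tannaka_counit_eq[OF adj]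
    by (simp_all only: LKKtW \<epsilon>KW F_def W_def F\<epsilon>KW_def) simp
  \<comment> \<open>The codomain is kept as \<open>F\<close> after \<open>W\<close>, the form that
    whiskering produces; \<open>FW\<close> turns it into \<open>cfun C\<close> at the end.\<close>
  have "vnat V PB PB (vcompose V PB F LKKtW) (vcompose V PB F W) F\<epsilon>KW"
    using T.vnat_whisker_left[OF PB T.vcategory_comodules PB LKKtW_vfunctor T.cofree_vfunctor
        T.forgetful_vfunctor, folded F_def W_def, OF \<epsilon>KW_vnat]
    by (simp only: F\<epsilon>KW_def)
  moreover have "vnat_invertible V PB PB (vcompose V PB F LKKtW) (vcompose V PB F W) F\<epsilon>KW
      \<longleftrightarrow> vnat_invertible V PB Q LKKtW W \<epsilon>KW"
    using T.vnat_invertible_forgetful[OF PB LKKtW_vfunctor T.cofree_vfunctor, folded F_def W_def,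
        OF \<epsilon>KW_vnat]
    by (simp only: F\<epsilon>KW_def)
  ultimately show ?thesis
    using FW counit by (simp only: cfun_eq)
qed

end
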